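(* Let $\mathsf{O}_D=\mathbb{P}[\mathsf{SINR}_D\le\tau]$ be the $\mathsf{SINR}$ outage probability of the typical D2D receiver in the model described in the context, with threshold $\tau>0$. Then $\mathsf{O}_D = 1-\exp[-\mathcal{K}_1]$, where $$\mathcal{K}_1=\frac{\tau\sigma_z^2}{\rho_d}+\frac{2\pi^2 d_o^2\,p_s p_f\lambda_D}{\beta\sin\left(\frac{2\pi}{\beta}\right)}\tau^{\frac{2}{\beta}}+\frac{2\pi q_d\lambda_B}{\alpha-2}\,\mathcal{G}\left[\left(\frac{\rho_d}{\gamma\tau}\right)^{\frac1\alpha}\Gamma\left(\frac{\alpha+1}{\alpha}\right),\alpha\right]\left(\frac{\bar P}{\rho_d}\tau\right)^{\frac{2}{\alpha}},$$ with $\bar P=P_B$ if the D2D channel is a downlink channel ($c_d\in\mathcal{C}_D$) and $\bar P=\rho_b/(\pi\lambda_B)^{\alpha/2}$ if it is an uplink channel ($c_d\in\mathcal{C}_U$), and where $\mathcal{G}[y,\alpha]=y^{2-\alpha}\,{}_2F_1\left[1,\frac{\alpha-2}{\alpha};\frac{2\alpha-2}{\alpha};-y^{-\alpha}\right]$ with ${}_2F_1$ the Gauss hypergeometric function.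
   Context: Parameters (all positive reals): densities $\lambda_B,\lambda_U,\lambda_D$ of base stations (BSs), cellular users, D2D transmitters; BS transmit power $P_B$; receiver sensitivities $\rho_b$ (BS) and $\rho_d$ (D2D); noise power $\sigma_z^2$; sensing threshold $\gamma$; D2D link distance $d_o$; path-loss exponents $\alpha>2$ (cellular transmitters) and $\beta>2$ (D2D transmitters); RF-to-DC efficiency $a\in(0,1]$. PPP means Poisson point process on $\mathbb{R}^2$. All fading power gains $h$ are i.i.d. $\mathrm{Exp}(1)$, independent of everything else. Channels: a finite set $\mathcal{C}$ is the disjoint union of $\mathcal{C}_D$ (downlink) and $\mathcal{C}_U$ (uplink); $c_d\in\mathcal{C}$ is the D2D channel. Number of users per BS: $N_u$ has pmf $\mathbb{P}\{N_u=n\}=\frac{b^b}{\Gamma(b)}\frac{\Gamma(n+b)}{\Gamma(n+1)}\frac{m^n}{(b+m)^{n+b}}$, $n\ge 0$, with $b=3.575$, $m=\lambda_U/\lambda_B$. Access probability $q_d$ of $c_d$ by a BS: $q_d=1-\sum_{n=0}^{|\mathcal{C}|-1}\frac{|\mathcal{C}|-n}{|\mathcal{C}|}\mathbb{P}\{N_u=n\}$ under the random spectrum access (RSA) policy, and $q_d=1-\sum_{n=0}^{|\mathcal{C}|-1}\mathbb{P}\{N_u=n\}$ under the prioritized spectrum access (PSA) policy. Uplink user power (channel inversion to the nearest BS): $P_u=\rho_b R^{\alpha}$ with $R$ of density $2\pi\lambda_B r e^{-\pi\lambda_B r^2}$, $r>0$, so $\mathbb{E}[P_u^{2/\alpha}]=\rho_b^{2/\alpha}/(\pi\lambda_B)$;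 powers of different users are independent. Each D2D transmitter has power $P_D=\rho_d d_o^{\beta}$. $p_f$ is the probability that a D2D transmitter at the origin finds $c_d$ free: transmitters using $c_d$ (BSs of power $P=P_B$ if $c_d\in\mathcal{C}_D$, users of i.i.d. random powers $P$ distributed as $P_u$ if $c_d\in\mathcal{C}_U$) form a PPP of intensity $q_d\lambda_B$, and $c_d$ is free iff no such transmitter $x$ has $P h_x\|x\|^{-\alpha}>\gamma$. $p_s=\mathbb{P}[P_{\rm H}>P_D]$, where the harvested power is $P_{\rm H}=a\sum_{x\in\tilde\Phi_B}\sum_{c\in\mathcal{C}_D}P_B h_{x,c}\|x\|^{-\alpha}+a\sum_{u\in\Phi_U'}P_u h_u\|u\|^{-\alpha}$, with independent PPPs $\tilde\Phi_B$ of intensity $q_c^{\rm D}\lambda_B$ and $\Phi_U'$ of intensity $q_c^{\rm U}|\mathcal{C}_U|\lambda_B$ with i.i.d. powers distributed as $P_u$; here $q_c^{\rm D}=1-\sum_{n=0}^{|\mathcal{C}_D|-1}\frac{|\mathcal{C}_D|-n}{|\mathcal{C}_D|}\mathbb{P}\{N_u=n\}$, and $q_c^{\rm U}$ is the same with $|\mathcal{C}_U|$ in place of $|\mathcal{C}_D|$. SINR model: the typical D2D receiver is at the origin and $\mathsf{SINR}_D=\frac{\rho_d h_{y_o}}{I_B+I_D+\sigma_z^2}$, where $h_{y_o}\sim\mathrm{Exp}(1)$, and $h_{y_o},I_B,I_D$ are independent. $I_D=\sum_{y}P_D h_y\|y\|^{-\beta}$ over a PPP of active D2D transmitters of intensity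 $p_sp_f\lambda_D$. $I_B=\sum_x P_x h_x\|x\|^{-\alpha}$, where the sum runs over those points $x$ of a PPP of intensity $q_d\lambda_B$, with independent marks $P_x$ ($P_x=P_B$ if $c_d\in\mathcal{C}_D$; $P_x$ distributed as $P_u$ if $c_d\in\mathcal{C}_U$), lying outside the protection radius: $\|x\|\ge (P_x/\gamma)^{1/\alpha}\,\Gamma\left(1+\frac1\alpha\right)$. *)

theory Defs
  imports "HOL-Probability.Probability"
begin

section \<open>The Gauss hypergeometric function\<close>

text \<open>
  Principal branch: the analytic continuation of the hypergeometric series from the unit disc to
  the plane cut along \<open>[1, \<infinity>)\<close>. On the cut plane the chosen function is unique by the identity
  theorem; on the cut itself the value is arbitrary.
\<close>

definition hyp2F1 :: "complex \<Rightarrow> complex \<Rightarrow> complex \<Rightarrow> complex \<Rightarrow> complex" where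
  "hyp2F1 a b c =
     (SOME F. F holomorphic_on (- complex_of_real ` {1..}) \<and>
              (\<forall>z\<in>ball 0 1. F z = eval_fps (fps_hypergeo [a, b] [c] 1) z))"

text \<open>
  The parameters and the argument are real and the argument is negative, so the value of
  \<^const>\<open>hyp2F1\<close> below is real and \<^const>\<open>Re\<close> is only a change of type.
\<close>

definition G_fun :: "real \<Rightarrow> real \<Rightarrow> real" where
  "G_fun y \<alpha> = y powr (2 - \<alpha>) *
     Re (hyp2F1 1 (of_real ((\<alpha> - 2) / \<alpha>)) (of_real ((2 * \<alpha> - 2) / \<alpha>)) (of_real (- (y powr (- \<alpha>)))))"


section \<open>Independently marked Poisson point processes in the plane\<close>

text \<open>
  A configuration \<open>(N, X, m)\<close> consists of the points \<open>X n\<close> with marks \<open>m n\<close> for \<open>enat n < N\<close>.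
  The values of \<open>X\<close> and \<open>m\<close> at the remaining indices carry no meaning. The cardinality \<open>N\<close> is
  explicit because a process of intensity \<open>0\<close> (such as the uplink users when there is no uplink
  channel) has no points.
\<close>

type_synonym plane = "real ^ 2"
type_synonym 'm config = "enat \<times> (nat \<Rightarrow> plane) \<times> (nat \<Rightarrow> 'm)"

definition ground :: "'m config \<Rightarrow> enat \<times> (nat \<Rightarrow> plane)" where
  "ground \<phi> = (fst \<phi>, fst (snd \<phi>))"

definition marks :: "'m config \<Rightarrow> nat \<Rightarrow> 'm" where
  "marks \<phi> = snd (snd \<phi>)"

definition ground_space :: "(enat \<times> (nat \<Rightarrow> plane)) measure" where
  "ground_space = count_space UNIV \<Otimes>\<^sub>M (\<Pi>\<^sub>M n\<in>UNIV. borel)"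

definition config_space :: "'m measure \<Rightarrow> 'm config measure" where
  "config_space Q = count_space UNIV \<Otimes>\<^sub>M (\<Pi>\<^sub>M n\<in>UNIV. borel) \<Otimes>\<^sub>M (\<Pi>\<^sub>M n\<in>UNIV. Q)"

definition config_sum :: "(plane \<Rightarrow> 'm \<Rightarrow> ennreal) \<Rightarrow> 'm config \<Rightarrow> ennreal" where
  "config_sum f = (\<lambda>(N, X, m). \<Sum>n. if enat n < N then f (X n) (m n) else 0)"

definition num_points :: "plane set \<Rightarrow> 'm config \<Rightarrow> ennreal" where
  "num_points B = config_sum (\<lambda>x _. indicator B x)"

context prob_space
begin

text \<open>
  Independence of two random elements of possibly different types (the library's \<open>indep_var\<close>
  requires equal types).
\<close>

definition indep_rv :: "'b measure \<Rightarrow> ('a \<Rightarrow> 'b) \<Rightarrow> 'c measure \<Rightarrow> ('a \<Rightarrow> 'c) \<Rightarrow> bool" where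
  "indep_rv S X T Y \<longleftrightarrow>
     random_variable S X \<and> random_variable T Y \<and>
     indep_set {X -` A \<inter> space M | A. A \<in> sets S} {Y -` A \<inter> space M | A. A \<in> sets T}"

definition poisson_points :: "real \<Rightarrow> ('a \<Rightarrow> 'm config) \<Rightarrow> bool" where
  "poisson_points \<mu> \<Phi> \<longleftrightarrow>
     (\<forall>B k. B \<in> sets borel \<longrightarrow> bounded B \<longrightarrow>
        prob {\<omega> \<in> space M. num_points B (\<Phi> \<omega>) = of_nat k} =
          (\<mu> * measure lborel B) ^ k / fact k * exp (- (\<mu> * measure lborel B))) \<and>
     (\<forall>(I :: nat set) B. finite I \<longrightarrow> (\<forall>i\<in>I. B i \<in> sets borel \<and> bounded (B i)) \<longrightarrow>
        disjoint_family_on B I \<longrightarrow>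
        indep_vars (\<lambda>_. borel) (\<lambda>i \<omega>. num_points (B i) (\<Phi> \<omega>)) I)"

text \<open>
  A homogeneous Poisson point process of intensity \<open>\<mu>\<close> whose marks are i.i.d. with law \<open>Q\<close> and
  independent of the points.
\<close>

definition marked_PPP :: "real \<Rightarrow> 'm measure \<Rightarrow> ('a \<Rightarrow> 'm config) \<Rightarrow> bool" where
  "marked_PPP \<mu> Q \<Phi> \<longleftrightarrow>
     random_variable (config_space Q) \<Phi> \<and>
     poisson_points \<mu> \<Phi> \<and>
     indep_vars (\<lambda>_. Q) (\<lambda>n \<omega>. marks (\<Phi> \<omega>) n) UNIV \<and>
     (\<forall>n. distr M Q (\<lambda>\<omega>. marks (\<Phi> \<omega>) n) = Q) \<and>
     indep_rv ground_space (\<lambda>\<omega>. ground (\<Phi> \<omega>)) (\<Pi>\<^sub>M n\<in>UNIV. Q) (\<lambda>\<omega>. marks (\<Phi> \<omega>))"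

end


section \<open>Spectrum access\<close>

datatype access_policy = RSA | PSA

definition users_prob :: "real \<Rightarrow> real \<Rightarrow> nat \<Rightarrow> real" where
  "users_prob lam\<^sub>U lam\<^sub>B n =
     (let b = 3.575; m = lam\<^sub>U / lam\<^sub>B in
       b powr b / Gamma b * (Gamma (real n + b) / Gamma (real n + 1)) *
       (m ^ n / (b + m) powr (real n + b)))"

definition RSA_prob :: "real \<Rightarrow> real \<Rightarrow> nat \<Rightarrow> real" where
  "RSA_prob lam\<^sub>U lam\<^sub>B k = 1 - (\<Sum>n<k. (real k - real n) / real k * users_prob lam\<^sub>U lam\<^sub>B n)"

definition PSA_prob :: "real \<Rightarrow> real \<Rightarrow> nat \<Rightarrow> real" where
  "PSA_prob lam\<^sub>U lam\<^sub>B k = 1 - (\<Sum>n<k. users_prob lam\<^sub>U lam\<^sub>B n)"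

fun access_prob :: "access_policy \<Rightarrow> real \<Rightarrow> real \<Rightarrow> nat \<Rightarrow> real" where
  "access_prob RSA lam\<^sub>U lam\<^sub>B k = RSA_prob lam\<^sub>U lam\<^sub>B k"
| "access_prob PSA lam\<^sub>U lam\<^sub>B k = PSA_prob lam\<^sub>U lam\<^sub>B k"


section \<open>Fading and transmit powers\<close>

definition fading_law :: "real measure" where
  "fading_law = density lborel (\<lambda>x. ennreal (exponential_density 1 x))"

text \<open>Law of \<open>\<rho>\<^sub>b R\<^sup>\<alpha>\<close>, with \<open>R\<close> the distance to the nearest base station.\<close>

definition user_power_law :: "real \<Rightarrow> real \<Rightarrow> real \<Rightarrow> real measure" where
  "user_power_law lam\<^sub>B \<rho>\<^sub>b \<alpha> =
     distr (density lborel
              (\<lambda>r. ennreal (if 0 < r then 2 * pi * lam\<^sub>B * r * exp (- pi * lam\<^sub>B * r\<^sup>2) else 0)))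
       borel (\<lambda>r. \<rho>\<^sub>b * r powr \<alpha>)"

text \<open>Law of the power of a cellular transmitter on a downlink (\<open>True\<close>) or uplink channel.\<close>

definition cellular_power_law :: "bool \<Rightarrow> real \<Rightarrow> real \<Rightarrow> real \<Rightarrow> real \<Rightarrow> real measure" where
  "cellular_power_law dl P\<^sub>B lam\<^sub>B \<rho>\<^sub>b \<alpha> =
     (if dl then return borel P\<^sub>B else user_power_law lam\<^sub>B \<rho>\<^sub>b \<alpha>)"


section \<open>Sensing, harvesting and interference\<close>

text \<open>Marks of cellular transmitters are pairs of transmit power and fading gain.\<close>

definition channel_free :: "real \<Rightarrow> real \<Rightarrow> (real \<times> real) config \<Rightarrow> bool" where
  "channel_free \<gamma> \<alpha> = (\<lambda>(N, X, m).
     \<not> (\<exists>n. enat n < N \<and> fst (m n) * snd (m n) * norm (X n) powr (- \<alpha>) > \<gamma>))"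

definition cellular_received :: "real \<Rightarrow> plane \<Rightarrow> real \<times> real \<Rightarrow> ennreal" where
  "cellular_received \<alpha> x = (\<lambda>(P, h). ennreal (P * h * norm x powr (- \<alpha>)))"

text \<open>Marks of the first process are the families of fading gains on the downlink channels.\<close>

definition harvested_power ::
  "real \<Rightarrow> real \<Rightarrow> real \<Rightarrow> 'c set \<Rightarrow> ('c \<Rightarrow> real) config \<Rightarrow> (real \<times> real) config \<Rightarrow> ennreal" where
  "harvested_power a P\<^sub>B \<alpha> C\<^sub>D \<phi>\<^sub>B \<phi>\<^sub>U =
     ennreal a * config_sum (\<lambda>x h. \<Sum>c\<in>C\<^sub>D. ennreal (P\<^sub>B * h c * norm x powr (- \<alpha>))) \<phi>\<^sub>B +
     ennreal a * config_sum (cellular_received \<alpha>) \<phi>\<^sub>U"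

definition cellular_interference :: "real \<Rightarrow> real \<Rightarrow> (real \<times> real) config \<Rightarrow> ennreal" where
  "cellular_interference \<gamma> \<alpha> =
     config_sum (\<lambda>x (P, h).
       if norm x \<ge> (P / \<gamma>) powr (1 / \<alpha>) * Gamma (1 + 1 / \<alpha>)
       then cellular_received \<alpha> x (P, h) else 0)"

definition D2D_interference :: "real \<Rightarrow> real \<Rightarrow> real config \<Rightarrow> ennreal" where
  "D2D_interference P\<^sub>D \<beta> = config_sum (\<lambda>y h. ennreal (P\<^sub>D * h * norm y powr (- \<beta>)))"

definition SINR :: "real \<Rightarrow> real \<Rightarrow> real \<Rightarrow> ennreal \<Rightarrow> ennreal \<Rightarrow> ennreal" where
  "SINR \<rho>\<^sub>d noise h I\<^sub>B I\<^sub>D = ennreal (\<rho>\<^sub>d * h) / (I\<^sub>B + I\<^sub>D + ennreal noise)"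

end

theory Submission
  imports Defs "HOL-Complex_Analysis.Complex_Analysis"
begin

text \<open>
  With \<open>s = \<tau> / \<rho>\<^sub>d\<close>, the receiver is not in outage iff the exponential gain \<open>h\<^sub>o\<close> exceeds
  \<open>s (I\<^sub>B + I\<^sub>D + noise)\<close>, so by independence the success probability is
  \<open>exp (- s noise)\<close> times the Laplace transforms of \<open>I\<^sub>B\<close> and \<open>I\<^sub>D\<close> at \<open>s\<close>. Both are instances of the
  Laplace functional \<open>exp (- \<mu> \<integral>\<integral> (1 - exp (- f x m)) dQ(m) dx)\<close> of a marked Poisson process. For
  \<open>I\<^sub>D\<close> the integral reduces to \<open>\<Gamma>(1 - 2/\<beta>) \<Gamma>(1 + 2/\<beta>)\<close> and hence to the reflection formula; for
  \<open>I\<^sub>B\<close>, polar coordinates and the substitution \<open>u = (R / r)\<close> to the power \<open>\<alpha> - 2\<close> turn it into Euler's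
  integral for the hypergeometric function. The radius \<open>R\<close> of the protection zone scales like the
  power of the transmitter to \<open>1/\<alpha>\<close>, so that the random power only enters through its moment of
  order \<open>2/\<alpha>\<close>.
\<close>

section \<open>The Laplace functional of a marked Poisson process\<close>

text \<open>Interferences are series in \<open>ennreal\<close> and may be infinite, so
  \<open>exp (- x)\<close> is extended to \<open>nexp\<close> with value \<open>0\<close> at
  infinity. The extension turns sums into products and reverses the order without any convergence
  hypothesis, and an infinite interference correctly counts as outage. The obstacle is that
  \<open>poisson_points\<close> speaks of counts only: their laws on bounded Borel sets and their
  independence over finitely many disjoint ones. The Laplace functional is therefore built from
  Poisson generating functions through simple functions of bounded support, every passage to the
  limit being monotone. The factor \<open>Gamma (1 + 1 / \<alpha>)\<close> in the protection radius
  is the mean of \<open>h powr (1 / \<alpha>)\<close> for a unit exponential \<open>h\<close>; the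
  radius is thus the mean distance at which a transmitter of the given power is received at the
  level \<open>\<gamma>\<close>.\<close>

definition nexp :: "ennreal \<Rightarrow> ennreal" where
  "nexp x = (if x = \<infinity> then 0 else ennreal (exp (- enn2real x)))"

text \<open>The case \<open>y = 0\<close> is separate because the real \<open>ln 0\<close> is
  \<open>0\<close>. For \<open>y \<ge> 1\<close> the value is \<open>0\<close>, so
  \<open>nexp\<close> is inverted on the unit interval only.\<close>

definition nlog :: "ennreal \<Rightarrow> ennreal" where
  "nlog y = (if y = 0 then \<infinity> else ennreal (- ln (enn2real y)))"

lemma nexp_ennreal [simp]: "0 \<le> x \<Longrightarrow> nexp (ennreal x) = ennreal (exp (- x))"
  by (simp add: nexp_def)

lemma nexp_infinity [simp]: "nexp \<infinity> = 0" "nexp top = 0"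
  by (simp_all add: nexp_def)

lemma nexp_0 [simp]: "nexp 0 = 1"
  by (simp add: nexp_def)

lemma nexp_le_1: "nexp x \<le> 1"
  by (simp add: nexp_def)

lemma nexp_less_top: "nexp x < top"
  using nexp_le_1[of x] by (metis ennreal_one_less_top order_le_less_trans)

lemma nexp_add: "nexp (x + y) = nexp x * nexp y"
  by (cases x; cases y) (auto simp: mult_exp_exp simp flip: ennreal_plus ennreal_mult)

lemma nexp_sum: "nexp (\<Sum>i\<in>A. f i) = (\<Prod>i\<in>A. nexp (f i))"
  by (induction A rule: infinite_finite_induct) (auto simp: nexp_add)

lemma nexp_less_iff: "nexp x < nexp y \<longleftrightarrow> y < x"
  by (cases x; cases y) (auto simp: ennreal_less_iff)

lemma nexp_le_iff: "nexp x \<le> nexp y \<longleftrightarrow> y \<le> x"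
  using nexp_less_iff[of y x] by (simp add: not_less flip: not_le)

lemma nexp_nlog: "y \<le> 1 \<Longrightarrow> nexp (nlog y) = y"
  by (cases y) (auto simp: nlog_def top_unique)

lemma measurable_nexp [measurable]: "nexp \<in> borel_measurable borel"
  unfolding nexp_def[abs_def] by measurable

lemma measurable_nlog [measurable]: "nlog \<in> borel_measurable borel"
  unfolding nlog_def[abs_def] by measurable

text \<open>\<open>nlog\<close> is adjoint to \<open>nexp\<close> below \<open>1\<close>, whence the continuity of \<open>nexp\<close> along suprema.\<close>

lemma nexp_SUP:
  fixes f :: "nat \<Rightarrow> ennreal"
  shows "nexp (SUP i. f i) = (INF i. nexp (f i))"
proof (rule antisym)
  show "nexp (SUP i. f i) \<le> (INF i. nexp (f i))"
    by (intro INF_greatest) (simp add: nexp_le_iff SUP_upper)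
  have *: "(INF i. nexp (f i)) \<le> 1"
    by (rule INF_lower2[of 0]) (auto simp: nexp_le_1)
  have "f i \<le> nlog (INF i. nexp (f i))" for i
  proof -
    have "(INF i. nexp (f i)) \<le> nexp (f i)" by (rule INF_lower) simp
    thus ?thesis by (subst (asm) nexp_nlog[OF *, symmetric]) (simp only: nexp_le_iff)
  qed
  hence "(SUP i. f i) \<le> nlog (INF i. nexp (f i))"
    by (rule SUP_least)
  thus "(INF i. nexp (f i)) \<le> nexp (SUP i. f i)"
    using nexp_nlog[OF *] by (metis nexp_le_iff)
qed

text \<open>Subtraction from \<open>1\<close> turns the decreasing limit into an increasing one, the
  form needed for monotone convergence over the plane, whose measure is infinite.\<close>

lemma one_minus_nexp_SUP:
  fixes f :: "nat \<Rightarrow> ennreal"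
  shows "1 - nexp (SUP i. f i) = (SUP i. 1 - nexp (f i))"
  unfolding nexp_SUP by (subst ennreal_INF_const_minus) (auto simp: nexp_le_1)

text \<open>Decreasing monotone convergence needs a finite integral; the bound
  \<open>nexp_le_1\<close> on a probability space provides it.\<close>

lemma nn_integral_nexp_SUP:
  fixes f :: "nat \<Rightarrow> 'a \<Rightarrow> ennreal"
  assumes "prob_space M" and [measurable]: "\<And>i. f i \<in> borel_measurable M" and "incseq f"
  shows "(\<integral>\<^sup>+x. nexp (SUP i. f i x) \<partial>M) = (INF i. \<integral>\<^sup>+x. nexp (f i x) \<partial>M)"
proof -
  interpret prob_space M by fact
  have "(\<integral>\<^sup>+x. nexp (f i x) \<partial>M) \<le> (\<integral>\<^sup>+x. 1 \<partial>M)" for i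
    by (intro nn_integral_mono nexp_le_1)
  hence "(\<integral>\<^sup>+x. nexp (f i x) \<partial>M) < \<infinity>" for i
    by (simp add: emeasure_space_1 order_le_less_trans[OF _ ennreal_one_less_top])
  moreover have "decseq (\<lambda>i x. nexp (f i x))"
    using \<open>incseq f\<close> by (auto simp: monotone_def le_fun_def nexp_le_iff)
  ultimately show ?thesis
    unfolding nexp_SUP by (subst nn_integral_monotone_convergence_INF_decseq) auto
qed

text \<open>The infinite product of the individual Laplace transforms is written as
  \<open>nexp\<close> of a series of \<open>nlog\<close>s. This avoids infinite products and has the
  shape of a \<open>config_sum\<close> again.\<close>

lemma nn_integral_iid_nexp_suminf:
  fixes F :: "nat \<Rightarrow> 'm \<Rightarrow> ennreal"
  assumes "prob_space Q" and [measurable]: "\<And>n. F n \<in> borel_measurable Q"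
  shows "(\<integral>\<^sup>+m. nexp (\<Sum>n. F n (m n)) \<partial>(\<Pi>\<^sub>M n\<in>UNIV. Q)) =
         nexp (\<Sum>n. nlog (\<integral>\<^sup>+x. nexp (F n x) \<partial>Q))"
proof -
  interpret Q: prob_space Q by fact
  interpret P: product_prob_space "\<lambda>_::nat. Q" UNIV ..
  let ?P = "\<Pi>\<^sub>M n\<in>(UNIV :: nat set). Q"
  have le1: "(\<integral>\<^sup>+x. nexp (F n x) \<partial>Q) \<le> 1" for n
    using nn_integral_mono[of Q "\<lambda>x. nexp (F n x)" "\<lambda>_. 1"]
    by (simp add: nexp_le_1 Q.emeasure_space_1)
  have fin: "(\<integral>\<^sup>+m. nexp (\<Sum>n<k. F n (m n)) \<partial>?P) = nexp (\<Sum>n<k. nlog (\<integral>\<^sup>+x. nexp (F n x) \<partial>Q))" for k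
  proof -
    interpret fp: finite_product_sigma_finite "\<lambda>_::nat. Q" "{..<k}" by standard simp
    \<comment> \<open>Only the coordinates below \<open>k\<close> matter. Inserting
      \<open>restrict\<close> makes the integrand factor through the projection to these
      coordinates, whose law is the finite product.\<close>
    have "(\<integral>\<^sup>+m. nexp (\<Sum>n<k. F n (m n)) \<partial>?P) = (\<integral>\<^sup>+m. (\<Prod>n<k. nexp (F n (restrict m {..<k} n))) \<partial>?P)"
      by (simp add: nexp_sum)
    also have "\<dots> = (\<integral>\<^sup>+m. (\<Prod>n<k. nexp (F n (m n))) \<partial>distr ?P (Pi\<^sub>M {..<k} (\<lambda>_. Q)) (\<lambda>x. restrict x {..<k}))"
      by (subst nn_integral_distr) auto
    also have "distr ?P (Pi\<^sub>M {..<k} (\<lambda>_. Q)) (\<lambda>x. restrict x {..<k}) = Pi\<^sub>M {..<k} (\<lambda>_. Q)"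
      by (rule P.distr_PiM_restrict_finite) auto
    also have "(\<integral>\<^sup>+m. (\<Prod>n<k. nexp (F n (m n))) \<partial>Pi\<^sub>M {..<k} (\<lambda>_. Q)) = (\<Prod>n<k. \<integral>\<^sup>+x. nexp (F n x) \<partial>Q)"
      by (intro P.product_nn_integral_prod) auto
    also have "\<dots> = nexp (\<Sum>n<k. nlog (\<integral>\<^sup>+x. nexp (F n x) \<partial>Q))"
      by (simp add: nexp_sum nexp_nlog[OF le1])
    finally show ?thesis .
  qed
  have "(\<integral>\<^sup>+m. nexp (\<Sum>n. F n (m n)) \<partial>?P) = (\<integral>\<^sup>+m. nexp (SUP k. \<Sum>n<k. F n (m n)) \<partial>?P)"
    by (simp add: suminf_eq_SUP)
  also have "\<dots> = (INF k. \<integral>\<^sup>+m. nexp (\<Sum>n<k. F n (m n)) \<partial>?P)"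
    by (intro nn_integral_nexp_SUP)
       (auto simp: incseq_def le_fun_def P.prob_space_axioms intro!: sum_mono2)
  also have "\<dots> = nexp (SUP k. \<Sum>n<k. nlog (\<integral>\<^sup>+x. nexp (F n x) \<partial>Q))"
    by (simp add: fin nexp_SUP)
  finally show ?thesis by (simp add: suminf_eq_SUP)
qed

section \<open>Sums over the points of a configuration\<close>

lemma config_sum_eq: "config_sum f \<phi> = (\<Sum>n. if enat n < fst \<phi> then f (fst (snd \<phi>) n) (snd (snd \<phi>) n) else 0)"
  by (simp add: config_sum_def case_prod_beta)

lemma measurable_config_sum:
  assumes f: "case_prod f \<in> borel_measurable (borel \<Otimes>\<^sub>M Q)"
  shows "config_sum f \<in> borel_measurable (config_space Q)"
proof -
  have N: "fst \<in> measurable (config_space Q) (count_space UNIV)"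
    and X: "(\<lambda>\<phi>. fst (snd \<phi>) n) \<in> measurable (config_space Q) borel"
    and m: "(\<lambda>\<phi>. snd (snd \<phi>) n) \<in> measurable (config_space Q) Q" for n
    unfolding config_space_def by measurable
  have "Measurable.pred (config_space Q) (\<lambda>\<phi>. enat n < fst \<phi>)" for n
    by (rule measurable_compose[OF N]) simp
  moreover have "(\<lambda>\<phi>. f (fst (snd \<phi>) n) (snd (snd \<phi>) n)) \<in> borel_measurable (config_space Q)" for n
    using measurable_compose[OF measurable_Pair[OF X m] f] by simp
  ultimately show ?thesis
    unfolding config_sum_eq[abs_def] by (intro borel_measurable_suminf_order measurable_If) (auto simp: pred_def)
qed

lemma config_sum_SUP:
  fixes f :: "nat \<Rightarrow> plane \<Rightarrow> 'm \<Rightarrow> ennreal"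
  assumes "incseq f"
  shows "config_sum (\<lambda>x m. SUP i. f i x m) \<phi> = (SUP i. config_sum (f i) \<phi>)"
proof -
  have "(SUP i. config_sum (f i) \<phi>) = (\<Sum>n. SUP i. if enat n < fst \<phi> then f i (fst (snd \<phi>) n) (snd (snd \<phi>) n) else 0)"
    unfolding config_sum_eq using assms
    by (intro ennreal_suminf_SUP_eq[symmetric]) (auto simp: incseq_def le_fun_def)
  thus ?thesis unfolding config_sum_eq by (auto intro!: suminf_cong)
qed

text \<open>Brings sums of step functions down to counts, the random variables that
  \<open>poisson_points\<close> controls.\<close>

lemma config_sum_sum_indicator:
  "config_sum (\<lambda>x _. \<Sum>i\<in>I. c i * indicator (B i) x) \<phi> = (\<Sum>i\<in>I. c i * num_points (B i) \<phi>)"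
proof -
  have "config_sum (\<lambda>x _. \<Sum>i\<in>I. c i * indicator (B i) x) \<phi> =
      (\<Sum>n. \<Sum>i\<in>I. c i * (if enat n < fst \<phi> then indicator (B i) (fst (snd \<phi>) n) else 0))"
    unfolding config_sum_eq by (intro suminf_cong) auto
  also have "\<dots> = (\<Sum>i\<in>I. c i * num_points (B i) \<phi>)"
    unfolding num_points_def config_sum_eq by (subst suminf_sum) (auto intro!: sum.cong)
  finally show ?thesis .
qed

lemma measurable_num_points:
  assumes [measurable]: "B \<in> sets borel"
  shows "num_points B \<in> borel_measurable (config_space Q)"
  unfolding num_points_def by (rule measurable_config_sum) measurable

section \<open>Laplace functionals of Poisson processes, without and with marks\<close>

context prob_space
begin

text \<open>The probability of exactly one point in the unit ball is \<open>v * exp (- v)\<close>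
  with \<open>v\<close> the intensity times a positive area, so \<open>v\<close> cannot be negative.
  This gives the sign of the intensities in the theorem without an analysis of the access
  probabilities.\<close>

lemma poisson_points_intensity_nonneg:
  assumes "poisson_points \<mu> \<Phi>"
  shows "0 \<le> \<mu>"
proof -
  have pos: "0 < measure lborel (ball (0::plane) 1)"
    using content_ball_pos[of 1 "0::plane"] by (simp add: measure_completion)
  have "bounded (ball (0::plane) 1)" by simp
  from assms[unfolded poisson_points_def, THEN conjunct1, rule_format, OF _ this, of 1]
  have "0 \<le> \<mu> * measure lborel (ball (0::plane) 1) * exp (- (\<mu> * measure lborel (ball (0::plane) 1)))"
    by (metis (no_types, lifting) borel_open div_by_1 fact_1 measure_nonneg open_ball power_one_right)
  with pos show ?thesis
    by (metis exp_gt_zero linorder_not_le mult_neg_pos)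
qed

text \<open>The generating function \<open>exp (l * (t - 1))\<close> of a Poisson variable of mean
  \<open>l\<close>, at \<open>t = exp (- c)\<close>.\<close>

lemma nn_integral_nexp_num_points:
  assumes PP: "poisson_points \<mu> \<Phi>" and rv[measurable]: "random_variable (config_space Q) \<Phi>"
    and B[measurable]: "B \<in> sets borel" "bounded B" and "c < \<infinity>"
  shows "(\<integral>\<^sup>+\<omega>. nexp (c * num_points B (\<Phi> \<omega>)) \<partial>M) =
         nexp (ennreal \<mu> * (emeasure lborel B * (1 - nexp c)))"
proof -
  obtain c' where c: "c = ennreal c'" "0 \<le> c'"
    using \<open>c < \<infinity>\<close> by (cases c) auto
  define l where "l = \<mu> * measure lborel B"
  have mu: "0 \<le> \<mu>" using poisson_points_intensity_nonneg[OF PP] .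
  have l: "0 \<le> l" using mu by (simp add: l_def)
  have [measurable]: "(\<lambda>\<omega>. num_points B (\<Phi> \<omega>)) \<in> borel_measurable M"
    by (rule measurable_compose[OF _ measurable_num_points[OF B(1)]]) (rule rv)
  define A where "A k = {\<omega> \<in> space M. num_points B (\<Phi> \<omega>) = of_nat k}" for k
  have A[measurable]: "A k \<in> events" for k unfolding A_def by measurable
  have p: "prob (A k) = l ^ k / fact k * exp (- l)" for k
    using PP B unfolding poisson_points_def A_def l_def by blast
  have disj: "disjoint_family A"
    by (auto simp: disjoint_family_on_def A_def)
  have sums: "(\<lambda>k. (t * l) ^ k / fact k * exp (- l)) sums (exp (t * l) * exp (- l))" for t
    using exp_converges[of "t * l"] by (intro sums_mult2) (simp add: field_simps)
  \<comment> \<open>The law is prescribed for natural values only. The instance \<open>t = 1\<close>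
    of \<open>sums\<close> shows that these carry the whole mass, so the count is almost surely
    finite; \<open>t = exp (- c')\<close> gives the transform below.\<close>
  have "prob (\<Union>k. A k) = 1"
    using sums_unique2[OF finite_measure_UNION[OF _ disj] , of 1] sums[of 1] A
    by (auto simp: p exp_minus_inverse image_subset_iff)
  hence AE: "AE \<omega> in M. \<omega> \<in> (\<Union>k. A k)"
    by (subst AE_prob_1) auto
  have "(\<integral>\<^sup>+\<omega>. nexp (c * num_points B (\<Phi> \<omega>)) \<partial>M) = (\<integral>\<^sup>+\<omega>. (\<Sum>k. nexp (c * of_nat k) * indicator (A k) \<omega>) \<partial>M)"
  proof (rule nn_integral_cong_AE, use AE in eventually_elim)
    fix \<omega> assume "\<omega> \<in> (\<Union>k. A k)"
    then obtain k where k: "\<omega> \<in> A k" by auto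
    hence "indicator (A j) \<omega> = (if j = k then 1 else 0 :: ennreal)" for j
      using k by (auto simp: A_def)
    hence "(\<Sum>j. nexp (c * of_nat j) * indicator (A j) \<omega>) = (\<Sum>j\<in>{k}. nexp (c * of_nat j) * indicator (A j) \<omega>)"
      by (intro suminf_finite) auto
    also have "\<dots> = nexp (c * of_nat k)"
      using k by simp
    also have "of_nat k = num_points B (\<Phi> \<omega>)"
      using k by (simp add: A_def)
    finally show "nexp (c * num_points B (\<Phi> \<omega>)) = (\<Sum>j. nexp (c * of_nat j) * indicator (A j) \<omega>)" ..
  qed
  also have "\<dots> = (\<Sum>k. nexp (c * of_nat k) * emeasure M (A k))"
    by (subst nn_integral_suminf) (auto simp: nn_integral_cmult_indicator)
  also have "\<dots> = (\<Sum>k. ennreal ((exp (- c') * l) ^ k / fact k * exp (- l)))"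
  proof (rule suminf_cong)
    fix k
    have "nexp (c * of_nat k) = ennreal (exp (- c') ^ k)"
    proof -
      have "c * of_nat k = ennreal (real k * c')"
        using c by (simp add: ennreal_of_nat_eq_real_of_nat ennreal_mult mult.commute)
      thus ?thesis using c by (simp add: exp_of_nat_mult[symmetric])
    qed
    thus "nexp (c * of_nat k) * emeasure M (A k) = ennreal ((exp (- c') * l) ^ k / fact k * exp (- l))"
      using l by (simp add: emeasure_eq_measure p power_mult_distrib flip: ennreal_mult)
  qed
  also have "\<dots> = ennreal (exp (exp (- c') * l) * exp (- l))"
    using l by (intro suminf_ennreal_eq sums) auto
  also have "\<dots> = ennreal (exp (- (\<mu> * (measure lborel B * (1 - exp (- c'))))))"
    unfolding l_def exp_add[symmetric] by (simp add: algebra_simps)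
  also have "\<dots> = nexp (ennreal \<mu> * (emeasure lborel B * (1 - nexp c)))"
  proof -
    have "emeasure lborel B = ennreal (measure lborel B)"
      using emeasure_bounded_finite[OF B(2)] by (simp add: emeasure_eq_ennreal_measure less_top)
    moreover have "1 - nexp c = ennreal (1 - exp (- c'))"
      using c ennreal_minus[of "exp (- c')" 1] by simp
    ultimately show ?thesis using mu c by (simp flip: ennreal_mult)
  qed
  finally show ?thesis .
qed

end

context prob_space
begin

text \<open>Counts in disjoint sets are independent, so the expectation of the product of the
  \<open>nexp\<close> factors splits and the exponents add up.\<close>

lemma nn_integral_nexp_ground_step:
  fixes B :: "nat \<Rightarrow> plane set"
  assumes PP: "poisson_points \<mu> \<Phi>" and rv: "random_variable (config_space Q) \<Phi>"
    and I: "finite I" and B: "\<And>i. i \<in> I \<Longrightarrow> B i \<in> sets borel" "\<And>i. i \<in> I \<Longrightarrow> bounded (B i)"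
    and disj: "disjoint_family_on B I" and c: "\<And>i. i \<in> I \<Longrightarrow> c i < \<infinity>"
  shows "(\<integral>\<^sup>+\<omega>. nexp (config_sum (\<lambda>x _. \<Sum>i\<in>I. c i * indicator (B i) x) (\<Phi> \<omega>)) \<partial>M) =
         nexp (ennreal \<mu> * (\<integral>\<^sup>+x. (1 - nexp (\<Sum>i\<in>I. c i * indicator (B i) x)) \<partial>lborel))"
proof -
  have "indep_vars (\<lambda>_. borel) (\<lambda>i \<omega>. num_points (B i) (\<Phi> \<omega>)) I"
    using PP I B disj unfolding poisson_points_def by blast
  hence indep: "indep_vars (\<lambda>_. borel) (\<lambda>i \<omega>. nexp (c i * num_points (B i) (\<Phi> \<omega>))) I"
    by (rule indep_vars_compose2) measurable
  \<comment> \<open>\<open>1 - nexp\<close> is not additive, but at most one of the disjoint sets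
    contains \<open>x\<close>, so at most one summand is nonzero.\<close>
  have one: "1 - nexp (\<Sum>i\<in>I. c i * indicator (B i) x) = (\<Sum>i\<in>I. (1 - nexp (c i)) * indicator (B i) x)" for x
  proof (cases "\<exists>j\<in>I. x \<in> B j")
    case True
    then obtain j where j: "j \<in> I" "x \<in> B j" by blast
    have ind: "indicator (B i) x = (if i = j then 1 else 0 :: ennreal)" if "i \<in> I" for i
      using disj j that by (auto simp: disjoint_family_on_def indicator_def)
    have "(\<Sum>i\<in>I. d i * indicator (B i) x) = d j" for d :: "nat \<Rightarrow> ennreal"
    proof -
      have "(\<Sum>i\<in>I. d i * indicator (B i) x) = (\<Sum>i\<in>I. if i = j then d j else 0)"
        by (rule sum.cong) (auto simp: ind)
      thus ?thesis using j I by simp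
    qed
    thus ?thesis by simp
  next
    case False
    hence "(\<Sum>i\<in>I. d i * indicator (B i) x) = 0" for d :: "nat \<Rightarrow> ennreal"
      by (intro sum.neutral) auto
    thus ?thesis by simp
  qed
  have "(\<integral>\<^sup>+\<omega>. nexp (config_sum (\<lambda>x _. \<Sum>i\<in>I. c i * indicator (B i) x) (\<Phi> \<omega>)) \<partial>M) =
        (\<integral>\<^sup>+\<omega>. (\<Prod>i\<in>I. nexp (c i * num_points (B i) (\<Phi> \<omega>))) \<partial>M)"
    by (simp add: config_sum_sum_indicator nexp_sum)
  also have "\<dots> = (\<Prod>i\<in>I. \<integral>\<^sup>+\<omega>. nexp (c i * num_points (B i) (\<Phi> \<omega>)) \<partial>M)"
    by (rule indep_vars_nn_integral[OF I indep]) simp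
  also have "\<dots> = (\<Prod>i\<in>I. nexp (ennreal \<mu> * (emeasure lborel (B i) * (1 - nexp (c i)))))"
    by (intro prod.cong refl nn_integral_nexp_num_points[OF PP rv]) (use B c in auto)
  also have "\<dots> = nexp (ennreal \<mu> * (\<Sum>i\<in>I. (1 - nexp (c i)) * emeasure lborel (B i)))"
    by (simp add: nexp_sum sum_distrib_left mult.commute)
  also have "(\<Sum>i\<in>I. (1 - nexp (c i)) * emeasure lborel (B i)) =
             (\<integral>\<^sup>+x. (\<Sum>i\<in>I. (1 - nexp (c i)) * indicator (B i) x) \<partial>lborel)"
    using B(1) by (subst nn_integral_sum) (auto simp: nn_integral_cmult_indicator)
  finally show ?thesis by (simp add: one)
qed

lemma nn_integral_nexp_ground_simple:
  fixes g :: "plane \<Rightarrow> ennreal"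
  assumes PP: "poisson_points \<mu> \<Phi>" and rv: "random_variable (config_space Q) \<Phi>"
    and g: "simple_function borel g" "\<And>x. g x < \<infinity>" "bounded {x. g x \<noteq> 0}"
  shows "(\<integral>\<^sup>+\<omega>. nexp (config_sum (\<lambda>x _. g x) (\<Phi> \<omega>)) \<partial>M) =
         nexp (ennreal \<mu> * (\<integral>\<^sup>+x. (1 - nexp (g x)) \<partial>lborel))"
proof -
  \<comment> \<open>The value \<open>0\<close> is left out because its level set is unbounded, while
    counts are controlled on bounded sets. The remaining values are numbered because
    \<open>poisson_points\<close> takes families indexed by naturals.\<close>
  define V where "V = range g - {0}"
  have fin: "finite V" using g(1) by (simp add: V_def simple_function_def)
  then obtain h :: "nat \<Rightarrow> ennreal" where h: "bij_betw h {0..<card V} V"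
    using ex_bij_betw_nat_finite by blast
  have g_eq: "g x = (\<Sum>i\<in>{0..<card V}. h i * indicator (g -` {h i}) x)" for x
  proof -
    have "(\<Sum>i\<in>{0..<card V}. h i * indicator (g -` {h i}) x) = (\<Sum>v\<in>V. v * indicator (g -` {v}) x)"
      by (rule sum.reindex_bij_betw[OF h])
    also have "\<dots> = (\<Sum>v\<in>V. if v = g x then g x else 0)"
      by (rule sum.cong) auto
    also have "\<dots> = g x"
      using fin by (auto simp: V_def)
    finally show ?thesis by simp
  qed
  have hV: "h i \<in> V" if "i < card V" for i
    using h that by (auto simp: bij_betw_def)
  have "g -` {h i} \<in> sets borel" for i
    using simple_functionD(2)[OF g(1), of "{h i}"] by simp
  moreover have "bounded (g -` {h i})" if "i < card V" for i
    using hV[OF that] by (intro bounded_subset[OF g(3)]) (auto simp: V_def)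
  moreover have "disjoint_family_on (\<lambda>i. g -` {h i}) {0..<card V}"
    using h by (auto simp: disjoint_family_on_def bij_betw_def inj_on_def)
  moreover have "h i < \<infinity>" if "i < card V" for i
    using hV[OF that] g(2) by (auto simp: V_def)
  ultimately show ?thesis
    using nn_integral_nexp_ground_step[OF PP rv, of "{0..<card V}" "\<lambda>i. g -` {h i}" h]
    by (simp flip: g_eq)
qed

lemma nn_integral_nexp_ground:
  fixes F :: "plane \<Rightarrow> ennreal"
  assumes PP: "poisson_points \<mu> \<Phi>" and rv: "random_variable (config_space Q) \<Phi>"
    and [measurable]: "F \<in> borel_measurable borel"
  shows "(\<integral>\<^sup>+\<omega>. nexp (config_sum (\<lambda>x _. F x) (\<Phi> \<omega>)) \<partial>M) =
         nexp (ennreal \<mu> * (\<integral>\<^sup>+x. (1 - nexp (F x)) \<partial>lborel))"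
proof -
  obtain U where U: "\<And>i. simple_function borel (U i)" "incseq U" "\<And>i x. U i x < top"
      "\<And>x. (SUP i. U i x) = F x"
    using borel_measurable_implies_simple_function_sequence'[of F borel] by auto
  \<comment> \<open>Cutting off at growing balls gives bounded support and keeps the sequence
    increasing.\<close>
  define g :: "nat \<Rightarrow> plane \<Rightarrow> ennreal" where "g i x = U i x * indicator (ball 0 (real i)) x" for i x
  have simple: "simple_function borel (g i)" for i
    unfolding g_def using U(1) by (intro simple_function_mult simple_function_indicator) auto
  have [measurable]: "g i \<in> borel_measurable borel" for i
    using simple by (rule borel_measurable_simple_function)
  have inc: "incseq g"
    using U(2) unfolding g_def incseq_def le_fun_def by (auto intro!: mult_mono split: split_indicator)
  have sup: "(SUP i. g i x) = F x" for x
  proof (rule antisym)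
    show "(SUP i. g i x) \<le> F x"
      unfolding U(4)[symmetric] g_def by (intro SUP_mono) (auto split: split_indicator)
    obtain k :: nat where k: "norm x < real k" using reals_Archimedean2 by blast
    show "F x \<le> (SUP i. g i x)"
      unfolding U(4)[symmetric]
    proof (rule SUP_mono)
      fix i
      \<comment> \<open>From index \<open>k\<close> on, \<open>x\<close> lies inside the cut-off
        ball, and the index is at least \<open>i\<close>, so the approximant has not
        decreased.\<close>
      have "U i x \<le> g (max i k) x"
        using k U(2) by (auto simp: g_def incseq_def le_fun_def)
      thus "\<exists>j\<in>UNIV. U i x \<le> g j x" by blast
    qed
  qed
  have eq: "(\<integral>\<^sup>+\<omega>. nexp (config_sum (\<lambda>x _. g i x) (\<Phi> \<omega>)) \<partial>M) =
         nexp (ennreal \<mu> * (\<integral>\<^sup>+x. (1 - nexp (g i x)) \<partial>lborel))" for i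
    by (rule nn_integral_nexp_ground_simple[OF PP rv simple])
       (use U(3) in \<open>auto simp: g_def indicator_def intro!: bounded_subset[OF bounded_ball[of 0 "real i"]]\<close>)
  have cs [measurable]: "(\<lambda>\<omega>. config_sum (\<lambda>x _. g i x) (\<Phi> \<omega>)) \<in> borel_measurable M" for i
    by (rule measurable_compose[OF rv measurable_config_sum]) measurable
  have "(\<integral>\<^sup>+\<omega>. nexp (config_sum (\<lambda>x _. F x) (\<Phi> \<omega>)) \<partial>M) =
        (\<integral>\<^sup>+\<omega>. nexp (SUP i. config_sum (\<lambda>x _. g i x) (\<Phi> \<omega>)) \<partial>M)"
    unfolding sup[symmetric] using inc
    by (intro nn_integral_cong arg_cong[of _ _ nexp] config_sum_SUP) (auto simp: incseq_def le_fun_def)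
  also have "\<dots> = (INF i. \<integral>\<^sup>+\<omega>. nexp (config_sum (\<lambda>x _. g i x) (\<Phi> \<omega>)) \<partial>M)"
  proof (rule nn_integral_nexp_SUP)
    show "incseq (\<lambda>i \<omega>. config_sum (\<lambda>x _. g i x) (\<Phi> \<omega>))"
      using inc unfolding incseq_def le_fun_def config_sum_eq by (auto intro!: suminf_le)
  qed (use prob_space_axioms in auto)
  also have "\<dots> = nexp (SUP i. ennreal \<mu> * (\<integral>\<^sup>+x. (1 - nexp (g i x)) \<partial>lborel))"
    by (simp add: eq nexp_SUP)
  also have "\<dots> = nexp (ennreal \<mu> * (\<integral>\<^sup>+x. (SUP i. 1 - nexp (g i x)) \<partial>lborel))"
    using inc by (subst nn_integral_monotone_convergence_SUP)
      (auto simp: SUP_mult_left_ennreal incseq_def le_fun_def nexp_le_iff intro!: ennreal_mono_minus)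
  finally show ?thesis by (simp add: sup flip: one_minus_nexp_SUP)
qed

text \<open>Independence as a product law, so that Tonelli can integrate out the marks with the
  points held fixed.\<close>

lemma distr_Pair_indep_rv:
  assumes "indep_rv S X T Y"
  shows "distr M (S \<Otimes>\<^sub>M T) (\<lambda>\<omega>. (X \<omega>, Y \<omega>)) = distr M S X \<Otimes>\<^sub>M distr M T Y"
proof (rule sym, rule pair_measure_eqI)
  have [measurable]: "random_variable S X" "random_variable T Y"
    using assms by (auto simp: indep_rv_def)
  show "sigma_finite_measure (distr M S X)" "sigma_finite_measure (distr M T Y)"
    by (auto intro!: prob_space_imp_sigma_finite prob_space_distr)
  fix A B assume "A \<in> sets (distr M S X)" "B \<in> sets (distr M T Y)"
  hence [measurable]: "A \<in> sets S" "B \<in> sets T" by auto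
  have "prob ((X -` A \<inter> space M) \<inter> (Y -` B \<inter> space M)) = prob (X -` A \<inter> space M) * prob (Y -` B \<inter> space M)"
    using assms unfolding indep_rv_def by (intro indep_setD[of "{X -` A \<inter> space M |A. A \<in> sets S}" "{Y -` A \<inter> space M |A. A \<in> sets T}"]) auto
  moreover have "(X -` A \<inter> space M) \<inter> (Y -` B \<inter> space M) = (\<lambda>\<omega>. (X \<omega>, Y \<omega>)) -` (A \<times> B) \<inter> space M"
    by auto
  ultimately show "emeasure (distr M S X) A * emeasure (distr M T Y) B =
      emeasure (distr M (S \<Otimes>\<^sub>M T) (\<lambda>\<omega>. (X \<omega>, Y \<omega>))) (A \<times> B)"
    by (simp add: emeasure_distr emeasure_eq_measure ennreal_mult[symmetric])
qed auto

text \<open>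
  Integrating out the marks, conditionally on the points, replaces the summand by the negative
  logarithm of its Laplace transform and so reduces the claim to unmarked processes.
\<close>

theorem marked_PPP_laplace_functional:
  fixes f :: "plane \<Rightarrow> 'm \<Rightarrow> ennreal"
  assumes PPP: "marked_PPP \<mu> Q \<Phi>" and Q: "prob_space Q"
    and f[measurable]: "case_prod f \<in> borel_measurable (borel \<Otimes>\<^sub>M Q)"
  shows "(\<integral>\<^sup>+\<omega>. nexp (config_sum f (\<Phi> \<omega>)) \<partial>M) =
         nexp (ennreal \<mu> * (\<integral>\<^sup>+x. \<integral>\<^sup>+m. (1 - nexp (f x m)) \<partial>Q \<partial>lborel))"
proof -
  interpret Q: prob_space Q by fact
  interpret P: product_prob_space "\<lambda>_::nat. Q" UNIV ..
  let ?PQ = "\<Pi>\<^sub>M n\<in>(UNIV :: nat set). Q"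
  let ?g = "\<lambda>\<omega>. ground (\<Phi> \<omega>)" and ?m = "\<lambda>\<omega>. marks (\<Phi> \<omega>)"
  have rv: "random_variable (config_space Q) \<Phi>" and PP: "poisson_points \<mu> \<Phi>"
    and iv: "indep_vars (\<lambda>_. Q) (\<lambda>n \<omega>. marks (\<Phi> \<omega>) n) UNIV"
    and law: "\<And>n. distr M Q (\<lambda>\<omega>. marks (\<Phi> \<omega>) n) = Q"
    and ind: "indep_rv ground_space ?g ?PQ ?m"
    using PPP by (auto simp: marked_PPP_def)
  have [measurable]: "random_variable ground_space ?g" "random_variable ?PQ ?m"
    using ind by (auto simp: indep_rv_def)
  have "distr M ?PQ ?m = ?PQ"
    using indep_vars_iff_distr_eq_PiM'[of UNIV "\<lambda>n \<omega>. marks (\<Phi> \<omega>) n" "\<lambda>_. Q"] iv law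
    by (simp add: indep_vars_def restrict_def)
  hence joint: "distr M (ground_space \<Otimes>\<^sub>M ?PQ) (\<lambda>\<omega>. (?g \<omega>, ?m \<omega>)) = distr M ground_space ?g \<Otimes>\<^sub>M ?PQ"
    by (simp add: distr_Pair_indep_rv[OF ind])
  define H where "H p = config_sum f (fst (fst p), snd (fst p), snd p)" for p
  define F where "F x = nlog (\<integral>\<^sup>+m. nexp (f x m) \<partial>Q)" for x
  have [measurable]: "F \<in> borel_measurable borel"
    unfolding F_def by measurable
  have fx[measurable]: "f x \<in> borel_measurable Q" for x
    using measurable_compose[OF measurable_Pair1' f, of x] by simp
  have H[measurable]: "H \<in> borel_measurable (ground_space \<Otimes>\<^sub>M ?PQ)"
  proof -
    have "(\<lambda>p. (fst (fst p), snd (fst p), snd p)) \<in> measurable (ground_space \<Otimes>\<^sub>M ?PQ) (config_space Q)"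
      unfolding ground_space_def config_space_def by measurable
    from measurable_compose[OF this measurable_config_sum[OF f]] show ?thesis
      unfolding H_def[abs_def] .
  qed
  have le1: "(\<integral>\<^sup>+m. nexp (f x m) \<partial>Q) \<le> 1" for x
    using nn_integral_mono[of Q "\<lambda>m. nexp (f x m)" "\<lambda>_. 1"]
    by (simp add: nexp_le_1 Q.emeasure_space_1)
  \<comment> \<open>\<open>m'\<close> is a dummy: the new summand \<open>F\<close> ignores marks,
    but a configuration has to carry some.\<close>
  have marks: "(\<integral>\<^sup>+m. nexp (H (g, m)) \<partial>?PQ) = nexp (config_sum (\<lambda>x _. F x) (fst g, snd g, m'))" for g and m' :: "nat \<Rightarrow> 'm"
  proof -
    let ?F = "\<lambda>n y. if enat n < fst g then f (snd g n) y else 0"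
    have "(\<integral>\<^sup>+m. nexp (H (g, m)) \<partial>?PQ) = (\<integral>\<^sup>+m. nexp (\<Sum>n. ?F n (m n)) \<partial>?PQ)"
      by (simp only: H_def config_sum_eq fst_conv snd_conv)
    also have "\<dots> = nexp (\<Sum>n. nlog (\<integral>\<^sup>+y. nexp (?F n y) \<partial>Q))"
      by (rule nn_integral_iid_nexp_suminf[OF Q]) simp
    \<comment> \<open>Beyond the number of points the factor is the total mass \<open>1\<close> of
      \<open>Q\<close>, whose \<open>nlog\<close> is \<open>0\<close>; the guard on the index thus
      survives.\<close>
    also have "(\<lambda>n. nlog (\<integral>\<^sup>+y. nexp (?F n y) \<partial>Q)) = (\<lambda>n. if enat n < fst g then F (snd g n) else 0)"
      by (auto simp: F_def fun_eq_iff Q.emeasure_space_1 nlog_def)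
    finally show ?thesis by (simp only: config_sum_eq fst_conv snd_conv)
  qed
  have "(\<integral>\<^sup>+\<omega>. nexp (config_sum f (\<Phi> \<omega>)) \<partial>M) = (\<integral>\<^sup>+\<omega>. nexp (H (?g \<omega>, ?m \<omega>)) \<partial>M)"
    by (simp add: H_def ground_def marks_def)
  also have "\<dots> = (\<integral>\<^sup>+p. nexp (H p) \<partial>(distr M ground_space ?g \<Otimes>\<^sub>M ?PQ))"
    unfolding joint[symmetric] by (subst nn_integral_distr) auto
  also have "\<dots> = (\<integral>\<^sup>+g. \<integral>\<^sup>+m. nexp (H (g, m)) \<partial>?PQ \<partial>distr M ground_space ?g)"
    by (rule P.nn_integral_fst[symmetric]) measurable
  also have "\<dots> = (\<integral>\<^sup>+\<omega>. \<integral>\<^sup>+m. nexp (H (?g \<omega>, m)) \<partial>?PQ \<partial>M)"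
    by (rule nn_integral_distr) measurable
  also have "\<dots> = (\<integral>\<^sup>+\<omega>. nexp (config_sum (\<lambda>x _. F x) (\<Phi> \<omega>)) \<partial>M)"
    by (simp only: marks[of _ undefined] ground_def config_sum_eq fst_conv snd_conv)
  also have "\<dots> = nexp (ennreal \<mu> * (\<integral>\<^sup>+x. (1 - nexp (F x)) \<partial>lborel))"
    by (rule nn_integral_nexp_ground[OF PP rv]) measurable
  finally have *: "(\<integral>\<^sup>+\<omega>. nexp (config_sum f (\<Phi> \<omega>)) \<partial>M) = nexp (ennreal \<mu> * (\<integral>\<^sup>+x. (1 - nexp (F x)) \<partial>lborel))" .
  \<comment> \<open>\<open>nexp\<close> undoes the \<open>nlog\<close> in \<open>F\<close>, and
    \<open>1\<close> is the total mass of \<open>Q\<close>, so the difference is again an integral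
    over the marks.\<close>
  have "1 - nexp (F x) = (\<integral>\<^sup>+m. (1 - nexp (f x m)) \<partial>Q)" for x
  proof -
    have "(\<integral>\<^sup>+m. (1 - nexp (f x m)) \<partial>Q) = (\<integral>\<^sup>+m. 1 \<partial>Q) - (\<integral>\<^sup>+m. nexp (f x m) \<partial>Q)"
      using le1[of x] by (intro nn_integral_diff)
        (auto simp: nexp_le_1 top_unique)
    thus ?thesis by (simp add: F_def nexp_nlog[OF le1] Q.emeasure_space_1)
  qed
  with * show ?thesis by simp
qed

end

section \<open>Path-loss integrals over the plane\<close>

lemma nn_integral_Gamma:
  assumes "0 < x"
  shows "(\<integral>\<^sup>+t. ennreal (t powr (x - 1) * exp (- t)) * indicator {0..} t \<partial>lborel) = ennreal (Gamma x)"
  using nn_integral_has_integral_lebesgue'[OF _ Gamma_integral_real[OF assms]]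
  by (simp add: exp_minus field_simps)

lemma Gamma_reflection_real:
  fixes p :: real
  shows "Gamma p * Gamma (1 - p) = pi / sin (pi * p)"
proof -
  have "complex_of_real (Gamma p * Gamma (1 - p)) = complex_of_real (pi / sin (pi * p))"
    using Gamma_reflection_complex[of "of_real p"]
    by (simp add: Gamma_complex_of_real[symmetric] sin_of_real[symmetric])
  thus ?thesis by (simp only: of_real_eq_iff)
qed

lemma emeasure_cball_plane:
  assumes "0 \<le> r"
  shows "emeasure lborel (cball (0::plane) r) = ennreal (pi * r\<^sup>2)"
  using emeasure_cball[OF assms, of "0::plane"] by (simp add: unit_ball_vol_2)

text \<open>The set is the punctured disc of radius
  \<open>(k / t) powr (1 / \<beta>)\<close>.\<close>

lemma emeasure_path_loss_superlevel:
  assumes "0 < \<beta>" "0 \<le> k" "0 < t"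
  shows "emeasure lborel {y::plane. t \<le> k * norm y powr (- \<beta>)} = ennreal (pi * k powr (2 / \<beta>) * t powr (- (2 / \<beta>)))"
proof (cases "k = 0")
  case True
  thus ?thesis using assms by simp
next
  case False
  hence k: "0 < k" using assms by simp
  let ?r = "(k / t) powr (1 / \<beta>)"
  \<comment> \<open>The origin is an exception: \<open>0 powr (- \<beta>)\<close> is
    \<open>0\<close>, so it lies outside the set although the path loss blows up there. As a null
    set it does not affect the area.\<close>
  have "(t \<le> k * norm y powr (- \<beta>)) \<longleftrightarrow> norm y \<le> ?r" if "y \<noteq> 0" for y :: plane
  proof -
    have "(t \<le> k * norm y powr (- \<beta>)) \<longleftrightarrow> norm y powr \<beta> \<le> k / t"
      using assms that by (simp add: powr_minus field_simps)
    also have "\<dots> \<longleftrightarrow> norm y powr \<beta> \<le> ?r powr \<beta>"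
      using assms k by (simp add: powr_powr)
    also have "\<dots> \<longleftrightarrow> norm y \<le> ?r"
      using assms by (metis norm_ge_zero powr_ge_zero powr_mono2 powr_less_mono2 not_le less_imp_le)
    finally show ?thesis .
  qed
  hence "y \<in> {y::plane. t \<le> k * norm y powr (- \<beta>)} \<longleftrightarrow> y \<in> cball 0 ?r - {0}" for y
    using assms by (cases "y = 0") auto
  hence "{y::plane. t \<le> k * norm y powr (- \<beta>)} = cball 0 ?r - {0}" by blast
  also have "emeasure lborel \<dots> = emeasure lborel (cball (0::plane) ?r)"
    by (rule emeasure_Diff_null_set) auto
  also have "\<dots> = ennreal (pi * ?r\<^sup>2)"
    by (rule emeasure_cball_plane) simp
  also have "?r\<^sup>2 = k powr (2 / \<beta>) * t powr (- (2 / \<beta>))"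
    using assms k by (simp add: powr_power power_divide powr_divide powr_minus_divide)
  finally show ?thesis by (simp add: mult.assoc)
qed

lemma nn_integral_exp_Icc:
  assumes "0 \<le> v"
  shows "(\<integral>\<^sup>+t. ennreal (exp (- t)) * indicator {0..v} t \<partial>lborel) = ennreal (1 - exp (- v))"
  using assms
  by (subst nn_integral_FTC_Icc[where F = "\<lambda>t. - exp (- t)"]) (auto intro!: derivative_eq_intros)

text \<open>Layer-cake formula: \<open>1 - exp (- v)\<close> is the integral of \<open>exp (- t)\<close> over \<open>t \<le> v\<close>.\<close>

lemma nn_integral_one_minus_exp_path_loss:
  assumes \<beta>: "2 < \<beta>" and k: "0 \<le> k"
  shows "(\<integral>\<^sup>+y. ennreal (1 - exp (- (k * norm (y::plane) powr (- \<beta>)))) \<partial>lborel) =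
         ennreal (pi * Gamma (1 - 2 / \<beta>) * k powr (2 / \<beta>))"
proof -
  have "(\<integral>\<^sup>+y. ennreal (1 - exp (- (k * norm (y::plane) powr (- \<beta>)))) \<partial>lborel) =
        (\<integral>\<^sup>+y. \<integral>\<^sup>+t. ennreal (exp (- t)) * indicator {0..k * norm (y::plane) powr (- \<beta>)} t \<partial>lborel \<partial>lborel)"
    using k by (simp add: nn_integral_exp_Icc)
  also have "\<dots> = (\<integral>\<^sup>+t. \<integral>\<^sup>+y. ennreal (exp (- t)) * indicator {0..k * norm (y::plane) powr (- \<beta>)} t \<partial>lborel \<partial>lborel)"
    by (rule lborel_pair.Fubini') (simp add: indicator_def case_prod_unfold)
  also have "\<dots> = (\<integral>\<^sup>+t. ennreal (pi * k powr (2 / \<beta>)) * (ennreal (t powr ((1 - 2 / \<beta>) - 1) * exp (- t)) * indicator {0..} t) \<partial>lborel)"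
  \<comment> \<open>At \<open>t = 0\<close> the inner integral is infinite, since the level set is
    the whole plane, but the right-hand side is \<open>0\<close>. The exponent is written
    \<open>(1 - 2 / \<beta>) - 1\<close> to show the Gamma integrand; \<open>2 < \<beta>\<close>
    makes its argument positive.\<close>
  proof (rule nn_integral_cong_AE, use AE_lborel_singleton[of 0] in eventually_elim)
    fix t :: real assume "t \<noteq> 0"
    show "(\<integral>\<^sup>+y. ennreal (exp (- t)) * indicator {0..k * norm (y::plane) powr (- \<beta>)} t \<partial>lborel) =
        ennreal (pi * k powr (2 / \<beta>)) * (ennreal (t powr ((1 - 2 / \<beta>) - 1) * exp (- t)) * indicator {0..} t)"
    proof (cases "0 < t")
      case True
      have "(\<integral>\<^sup>+y. ennreal (exp (- t)) * indicator {0..k * norm (y::plane) powr (- \<beta>)} t \<partial>lborel) =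
            (\<integral>\<^sup>+y. ennreal (exp (- t)) * indicator {y::plane. t \<le> k * norm y powr (- \<beta>)} y \<partial>lborel)"
        using True by (intro nn_integral_cong) (auto simp: indicator_def)
      also have "\<dots> = ennreal (exp (- t)) * ennreal (pi * k powr (2 / \<beta>) * t powr (- (2 / \<beta>)))"
        using True \<beta> k by (subst nn_integral_cmult_indicator) (auto simp: emeasure_path_loss_superlevel)
      finally show ?thesis using True by (simp add: ac_simps flip: ennreal_mult)
    next
      case False
      with \<open>t \<noteq> 0\<close> show ?thesis by (simp add: indicator_def)
    qed
  qed
  also have "\<dots> = ennreal (pi * k powr (2 / \<beta>)) * ennreal (Gamma (1 - 2 / \<beta>))"
    using \<beta> by (subst nn_integral_cmult) (use nn_integral_Gamma[of "1 - 2 / \<beta>"] \<beta> in auto)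
  finally show ?thesis using \<beta> by (simp add: ac_simps Gamma_real_pos flip: ennreal_mult)
qed

section \<open>Averages over exponential fading\<close>

lemma sets_fading_law [measurable_cong, simp]: "sets fading_law = sets borel"
  by (simp add: fading_law_def)

lemma prob_space_fading_law: "prob_space fading_law"
  unfolding fading_law_def by (rule prob_space_exponential_density) simp

lemma nn_integral_fading_law:
  assumes [measurable]: "f \<in> borel_measurable borel"
  shows "(\<integral>\<^sup>+h. f h \<partial>fading_law) = (\<integral>\<^sup>+h. ennreal (exp (- h)) * f h * indicator {0..} h \<partial>lborel)"
  unfolding fading_law_def exponential_density_def
  by (subst nn_integral_density) (auto intro!: nn_integral_cong simp: indicator_def)

text \<open>For a fixed gain \<open>h\<close> the integral over the plane is proportional to
  \<open>h powr (2 / \<beta>)\<close>, so the fading contributes the moment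
  \<open>Gamma (1 + 2 / \<beta>)\<close>.\<close>

lemma nn_integral_fading_path_loss:
  assumes \<beta>: "2 < \<beta>" and k: "0 \<le> k"
  shows "(\<integral>\<^sup>+y. \<integral>\<^sup>+h. (1 - nexp (ennreal (k * h * norm (y::plane) powr (- \<beta>)))) \<partial>fading_law \<partial>lborel) =
         ennreal (2 * pi\<^sup>2 / (\<beta> * sin (2 * pi / \<beta>)) * k powr (2 / \<beta>))"
proof -
  interpret F: prob_space fading_law by (rule prob_space_fading_law)
  interpret pair_sigma_finite "lborel :: plane measure" fading_law ..
  let ?p = "2 / \<beta>"
  have p: "0 < ?p" "?p < 1" using \<beta> by auto
  have "(\<integral>\<^sup>+y. \<integral>\<^sup>+h. (1 - nexp (ennreal (k * h * norm (y::plane) powr (- \<beta>)))) \<partial>fading_law \<partial>lborel) =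
      (\<integral>\<^sup>+h. \<integral>\<^sup>+y. (1 - nexp (ennreal (k * h * norm (y::plane) powr (- \<beta>)))) \<partial>lborel \<partial>fading_law)"
    by (rule Fubini'[symmetric]) measurable
  also have "\<dots> = (\<integral>\<^sup>+h. ennreal (exp (- h)) * (\<integral>\<^sup>+y. (1 - nexp (ennreal (k * h * norm (y::plane) powr (- \<beta>)))) \<partial>lborel) * indicator {0..} h \<partial>lborel)"
    by (rule nn_integral_fading_law) measurable
  also have "\<dots> = (\<integral>\<^sup>+h. ennreal (pi * Gamma (1 - ?p) * k powr ?p) * (ennreal (h powr ((1 + ?p) - 1) * exp (- h)) * indicator {0..} h) \<partial>lborel)"
  proof (intro nn_integral_cong)
    fix h :: real
    show "ennreal (exp (- h)) * (\<integral>\<^sup>+y. (1 - nexp (ennreal (k * h * norm (y::plane) powr (- \<beta>)))) \<partial>lborel) * indicator {0..} h =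
        ennreal (pi * Gamma (1 - ?p) * k powr ?p) * (ennreal (h powr ((1 + ?p) - 1) * exp (- h)) * indicator {0..} h)"
    proof (cases "0 \<le> h")
      case True
      have "1 - nexp (ennreal (k * h * norm (y::plane) powr (- \<beta>))) = ennreal (1 - exp (- (k * h * norm y powr (- \<beta>))))" for y
        using True k ennreal_minus[of "exp (- (k * h * norm y powr (- \<beta>)))" 1] by simp
      hence "(\<integral>\<^sup>+y. (1 - nexp (ennreal (k * h * norm (y::plane) powr (- \<beta>)))) \<partial>lborel) =
          ennreal (pi * Gamma (1 - ?p) * (k * h) powr ?p)"
        using nn_integral_one_minus_exp_path_loss[OF \<beta>, of "k * h"] True k by simp
      thus ?thesis using True k p
        by (simp add: powr_mult Gamma_real_pos ac_simps flip: ennreal_mult)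
    qed simp
  qed
  also have "\<dots> = ennreal (pi * Gamma (1 - ?p) * k powr ?p) * ennreal (Gamma (1 + ?p))"
    using p by (subst nn_integral_cmult) (use nn_integral_Gamma[of "1 + ?p"] p in auto)
  also have "\<dots> = ennreal (pi * Gamma (1 - ?p) * k powr ?p * Gamma (1 + ?p))"
  proof -
    have "0 < Gamma (1 - ?p)" "0 < Gamma (1 + ?p)"
      using p by (intro Gamma_real_pos; linarith)+
    thus ?thesis by (intro ennreal_mult[symmetric] mult_nonneg_nonneg) auto
  qed
  \<comment> \<open>\<open>Gamma (1 + ?p) = ?p * Gamma ?p\<close> prepares the reflection formula
    and is the source of the factor \<open>2 / \<beta>\<close>.\<close>
  also have "pi * Gamma (1 - ?p) * k powr ?p * Gamma (1 + ?p) = pi * k powr ?p * ?p * (Gamma ?p * Gamma (1 - ?p))"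
  proof -
    have "?p \<notin> \<int>\<^sub>\<le>\<^sub>0" using p(1) nonpos_Ints_nonpos[of ?p] by linarith
    thus ?thesis by (simp add: Gamma_plus1 add.commute[of 1] mult.commute mult.left_commute)
  qed
  also have "\<dots> = 2 * pi\<^sup>2 / (\<beta> * sin (2 * pi / \<beta>)) * k powr ?p"
    unfolding Gamma_reflection_real by (simp add: power2_eq_square mult.commute)
  finally show ?thesis .
qed

text \<open>The integrand is the difference of \<open>exp (- h)\<close> and
  \<open>exp (- ((1 + v) * h))\<close> on the half line, with integrals \<open>1\<close> and
  \<open>1 / (1 + v)\<close>.\<close>

lemma nn_integral_fading_law_one_minus_nexp:
  assumes v: "0 \<le> v"
  shows "(\<integral>\<^sup>+h. (1 - nexp (ennreal (v * h))) \<partial>fading_law) = ennreal (v / (1 + v))"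
proof -
  have "(\<integral>\<^sup>+h. (1 - nexp (ennreal (v * h))) \<partial>fading_law) =
        (\<integral>\<^sup>+h. ennreal (exp (- h)) * (1 - nexp (ennreal (v * h))) * indicator {0..} h \<partial>lborel)"
    by (rule nn_integral_fading_law) measurable
  also have "\<dots> = (\<integral>\<^sup>+h. ennreal (exp (- h) * (1 - exp (- (v * h)))) * indicator {0..} h \<partial>lborel)"
  proof (intro nn_integral_cong)
    fix h :: real
    show "ennreal (exp (- h)) * (1 - nexp (ennreal (v * h))) * indicator {0..} h =
        ennreal (exp (- h) * (1 - exp (- (v * h)))) * indicator {0..} h"
      using v ennreal_minus[of "exp (- (v * h))" 1]
      by (cases "0 \<le> h") (simp_all flip: ennreal_mult)
  qed
  also have "\<dots> = ennreal (0 - (- exp (- 0) + exp (- ((1 + v) * 0)) / (1 + v)))"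
  proof (rule nn_integral_FTC_atLeast)
    show "((\<lambda>h. - exp (- h) + exp (- ((1 + v) * h)) / (1 + v)) \<longlongrightarrow> 0) at_top"
    proof -
      have *: "((\<lambda>h. exp (- (w * h))) \<longlongrightarrow> 0) at_top" if "0 < w" for w :: real
        by (rule filterlim_compose[OF exp_at_bot])
           (simp add: filterlim_uminus_at_bot filterlim_tendsto_pos_mult_at_top[OF tendsto_const that filterlim_ident])
      have "((\<lambda>h. - exp (- (1 * h)) + exp (- ((1 + v) * h)) / (1 + v)) \<longlongrightarrow> - 0 + 0 / (1 + v)) at_top"
        using v by (intro tendsto_intros *) auto
      thus ?thesis by simp
    qed
    show "((\<lambda>h. - exp (- h) + exp (- ((1 + v) * h)) / (1 + v)) has_real_derivative
        exp (- h) * (1 - exp (- (v * h)))) (at h)" for h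
    proof -
      have "((\<lambda>h. - exp (- h) + exp (- ((1 + v) * h)) / (1 + v)) has_real_derivative
        exp (- h) + - (1 + v) * exp (- ((1 + v) * h)) / (1 + v)) (at h)"
        using v by (auto intro!: derivative_eq_intros)
      also have "- (1 + v) * exp (- ((1 + v) * h)) / (1 + v) = - exp (- ((1 + v) * h))"
        using v by (simp add: divide_simps add_eq_0_iff algebra_simps)
      also have "exp (- ((1 + v) * h)) = exp (- h) * exp (- (v * h))"
        by (simp add: algebra_simps flip: exp_add)
      finally show ?thesis by (simp add: algebra_simps)
    qed
  qed (use v in auto)
  also have "0 - (- exp (- 0) + exp (- ((1 + v) * 0)) / (1 + v)) = v / (1 + v)"
    using v by (simp add: field_simps)
  finally show ?thesis .
qed

text \<open>Polar coordinates for radial functions: both measures give \<open>pi * a\<^sup>2\<close>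
  to \<open>{..a}\<close> for \<open>a \<ge> 0\<close>, and these half lines form an
  intersection-stable generator.\<close>

lemma distr_norm_plane:
  "distr lborel borel (norm :: plane \<Rightarrow> real) = density lborel (\<lambda>r. ennreal (2 * pi * r) * indicator {0..} r)"
proof (rule measure_eqI_generator_eq[where E = "range atMost" and \<Omega> = UNIV and A = "\<lambda>n. {..real n}"])
  have 1: "emeasure (distr lborel borel (norm :: plane \<Rightarrow> real)) {..a} = (if 0 \<le> a then ennreal (pi * a\<^sup>2) else 0)" for a
  proof -
    have "norm -` {..a} = (if 0 \<le> a then cball (0::plane) a else {})"
      by (auto simp: vimage_def) (meson norm_ge_zero order_trans)
    thus ?thesis by (simp add: emeasure_distr emeasure_cball_plane)
  qed
  have 2: "emeasure (density lborel (\<lambda>r. ennreal (2 * pi * r) * indicator {0..} r)) {..a} = (if 0 \<le> a then ennreal (pi * a\<^sup>2) else 0)" for a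
  proof -
    have "emeasure (density lborel (\<lambda>r. ennreal (2 * pi * r) * indicator {0..} r)) {..a} =
        (\<integral>\<^sup>+r. ennreal (2 * pi * r) * indicator {0..a} r \<partial>lborel)"
      by (subst emeasure_density) (auto intro!: nn_integral_cong simp: indicator_def)
    also have "\<dots> = (if 0 \<le> a then ennreal (pi * a\<^sup>2) else 0)"
    proof (cases "0 \<le> a")
      case True
      thus ?thesis
        by (subst nn_integral_FTC_Icc[where F = "\<lambda>r. pi * r\<^sup>2"]) (auto intro!: derivative_eq_intros)
    qed simp
    finally show ?thesis .
  qed
  show "emeasure (distr lborel borel (norm :: plane \<Rightarrow> real)) X =
      emeasure (density lborel (\<lambda>r. ennreal (2 * pi * r) * indicator {0..} r)) X" if "X \<in> range atMost" for X
    using that by (auto simp: 1 2)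
  show "Int_stable (range (atMost :: real \<Rightarrow> real set))"
    by (auto simp: Int_stable_def)
  show "(\<Union>i. {..real i}) = UNIV"
    using real_arch_simple by auto
  show "emeasure (distr lborel borel (norm :: plane \<Rightarrow> real)) {..real i} \<noteq> \<infinity>" for i
    by (simp add: 1)
  show "sets (distr lborel borel (norm :: plane \<Rightarrow> real)) = sigma_sets UNIV (range atMost)"
    "sets (density lborel (\<lambda>r. ennreal (2 * pi * r) * indicator {0..} r)) = sigma_sets UNIV (range atMost)"
    by (simp_all add: borel_eq_atMost)
qed auto

lemma nn_integral_radial_plane:
  assumes [measurable]: "f \<in> borel_measurable borel"
  shows "(\<integral>\<^sup>+x. f (norm (x::plane)) \<partial>lborel) = (\<integral>\<^sup>+r. ennreal (2 * pi * r) * f r * indicator {0..} r \<partial>lborel)"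
proof -
  have "(\<integral>\<^sup>+x. f (norm (x::plane)) \<partial>lborel) = (\<integral>\<^sup>+r. f r \<partial>distr lborel borel (norm :: plane \<Rightarrow> real))"
    by (subst nn_integral_distr) auto
  thus ?thesis unfolding distr_norm_plane by (subst (asm) nn_integral_density) (auto simp: ac_simps)
qed

text \<open>Up to a constant, \<open>r powr (1 - \<alpha>)\<close> is the derivative of
  \<open>r powr (2 - \<alpha>)\<close>. In the variable
  \<open>u = (R / r) powr (\<alpha> - 2)\<close> the numerator and the area element therefore
  contribute the constant \<open>D\<close>, and only the denominator is left, on the unit
  interval.\<close>

lemma nn_integral_path_loss_outside_disc:
  assumes \<alpha>: "2 < \<alpha>" and R: "0 < R" and k: "0 \<le> k"
  shows "(\<integral>\<^sup>+x. (if R \<le> norm (x::plane) then ennreal (k * norm x powr (- \<alpha>) / (1 + k * norm x powr (- \<alpha>))) else 0) \<partial>lborel) =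
    ennreal (2 * pi / (\<alpha> - 2) * R powr (2 - \<alpha>) * k * integral {0..1} (\<lambda>u. 1 / (1 + k * R powr (- \<alpha>) * u powr (\<alpha> / (\<alpha> - 2)))))"
proof -
  define c where "c = 1 / (\<alpha> - 2)"
  have c: "0 < c" using \<alpha> by (simp add: c_def)
  define g where "g u = R * u powr (- c)" for u
  define g' where "g' u = R * (- c * u powr (- c - 1))" for u
  define f where "f r = 2 * pi * r * (k * r powr (- \<alpha>) / (1 + k * r powr (- \<alpha>)))" for r
  define D where "D = 2 * pi / (\<alpha> - 2) * R powr (2 - \<alpha>) * k"
  \<comment> \<open>The exponent of \<open>u\<close> is positive, so \<open>w\<close> is continuous
    up to \<open>u = 0\<close> and hence integrable.\<close>
  define w where "w u = 1 / (1 + k * R powr (- \<alpha>) * u powr (\<alpha> / (\<alpha> - 2)))" for u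
  have den: "0 < 1 + k * r powr s" for r s :: real
    using k by (simp add: add_pos_nonneg)
  have den': "0 < 1 + k * R powr (- \<alpha>) * u powr s" for u s :: real
    using k by (simp add: add_pos_nonneg)
  have w_cont: "continuous_on {0..1} w"
    unfolding w_def using \<alpha> den'
    by (auto intro!: continuous_intros continuous_on_powr' simp: less_imp_neq[symmetric])
  have w_abs: "w absolutely_integrable_on {0<..<1}"
    by (rule set_integrable_subset[OF absolutely_integrable_continuous_real[OF w_cont]]) auto
  have subst: "\<bar>g' u\<bar> * f (g u) = D * w u" if u: "u \<in> {0<..<1}" for u
  proof -
    have u': "0 < u" using u by simp
    have gp: "g u powr (- \<alpha>) = R powr (- \<alpha>) * u powr (\<alpha> / (\<alpha> - 2))"
      using u' R by (simp add: g_def powr_mult powr_powr c_def)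
    \<comment> \<open>The three powers come from the derivative of \<open>g\<close>, from the factor
      \<open>r\<close> of the area element and from the path loss; they cancel exactly.\<close>
    have e: "u powr (- c - 1) * u powr (- c) * u powr (\<alpha> / (\<alpha> - 2)) = 1"
    proof -
      have "- c - 1 + - c + \<alpha> / (\<alpha> - 2) = 0"
        using \<alpha> by (simp add: c_def divide_simps)
      thus ?thesis using u' by (simp flip: powr_add)
    qed
    have RR: "R * R * R powr (- \<alpha>) = R powr (2 - \<alpha>)"
      using R by (simp add: powr_diff powr_minus power2_eq_square divide_inverse)
    have "\<bar>g' u\<bar> * f (g u) =
        (R * (c * u powr (- c - 1))) * (2 * pi * (R * u powr (- c)) * (k * (R powr (- \<alpha>) * u powr (\<alpha> / (\<alpha> - 2))) * w u))"
      using c R unfolding f_def gp w_def by (simp add: g'_def g_def abs_mult mult.assoc)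
    also have "\<dots> = 2 * pi * c * (R * R * R powr (- \<alpha>)) * k * (u powr (- c - 1) * u powr (- c) * u powr (\<alpha> / (\<alpha> - 2))) * w u"
      by (simp only: ac_simps)
    also have "\<dots> = D * w u"
      unfolding e RR by (simp add: D_def c_def)
    finally show ?thesis .
  qed
  have img: "g ` {0<..<1} = {R<..}"
  proof (intro equalityI subsetI)
    fix r assume "r \<in> g ` {0<..<1}"
    then obtain u where u: "0 < u" "u < 1" "r = R * u powr (- c)" by (auto simp: g_def)
    have "1 < u powr (- c)"
      using u c powr_less_mono2[of c u 1] by (simp add: powr_minus one_less_inverse)
    thus "r \<in> {R<..}" using u R by simp
  next
    fix r assume r: "r \<in> {R<..}"
    define u where "u = (R / r) powr (1 / c)"
    have Rr: "0 < R / r" "R / r < 1" using r R by auto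
    have "0 < u" "u < 1" using Rr c powr_less_mono2[of "1 / c" "R / r" 1] by (auto simp: u_def)
    moreover have "g u = r"
      using Rr c R r by (simp add: g_def u_def powr_powr powr_minus)
    ultimately show "r \<in> g ` {0<..<1}" by force
  qed
  have "(\<lambda>u. \<bar>g' u\<bar> * f (g u)) absolutely_integrable_on {0<..<1} \<and>
      integral {0<..<1} (\<lambda>u. \<bar>g' u\<bar> * f (g u)) = D * integral {0..1} w"
  proof
    have "(\<lambda>u. D * w u) absolutely_integrable_on {0<..<1}"
      using w_abs by (rule set_integrable_mult_right)
    thus "(\<lambda>u. \<bar>g' u\<bar> * f (g u)) absolutely_integrable_on {0<..<1}"
      by (rule set_integrable_cong[THEN iffD1, rotated -1]) (auto simp: subst)
    have "integral {0<..<1} (\<lambda>u. \<bar>g' u\<bar> * f (g u)) = integral {0<..<1} (\<lambda>u. D * w u)"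
      by (rule integral_cong) (simp add: subst)
    thus "integral {0<..<1} (\<lambda>u. \<bar>g' u\<bar> * f (g u)) = D * integral {0..1} w"
      by (simp add: integral_open_interval_real)
  qed
  \<comment> \<open>The change of variables is an equivalence whose left-hand side has just been
    shown on the bounded interval; it yields both integrability and the value on the unbounded
    one.\<close>
  also have "?this \<longleftrightarrow> f absolutely_integrable_on (g ` {0<..<1}) \<and> integral (g ` {0<..<1}) f = D * integral {0..1} w"
  proof (rule has_absolute_integral_change_of_variables_1')
    show "(g has_field_derivative g' x) (at x within {0<..<1})" if "x \<in> {0<..<1}" for x
      unfolding g_def g'_def using that by (auto intro!: derivative_eq_intros)
    show "inj_on g {0<..<1}"
      by (rule inj_on_inverseI[where g = "\<lambda>r. (r / R) powr (- (1 / c))"])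
         (use R c in \<open>simp add: g_def powr_powr\<close>)
  qed auto
  finally have "(f has_integral (D * integral {0..1} w)) {R<..}"
    unfolding img by (metis has_integral_integral set_lebesgue_integral_eq_integral(1))
  hence *: "(\<integral>\<^sup>+r. ennreal (f r) * indicator {R<..} r \<partial>lborel) = ennreal (D * integral {0..1} w)"
  proof (rule nn_integral_has_integral_lebesgue'[rotated])
    show "0 \<le> f x" if "x \<in> {R<..}" for x
      using that R k den[of x "- \<alpha>"] by (simp add: f_def)
  qed
  have "(\<integral>\<^sup>+x. (if R \<le> norm (x::plane) then ennreal (k * norm x powr (- \<alpha>) / (1 + k * norm x powr (- \<alpha>))) else 0) \<partial>lborel) =
    (\<integral>\<^sup>+r. ennreal (2 * pi * r) * (if R \<le> r then ennreal (k * r powr (- \<alpha>) / (1 + k * r powr (- \<alpha>))) else 0) * indicator {0..} r \<partial>lborel)"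
    by (rule nn_integral_radial_plane) measurable
  also have "\<dots> = (\<integral>\<^sup>+r. ennreal (f r) * indicator {R<..} r \<partial>lborel)"
  \<comment> \<open>The protection condition is the weak inequality, but the image of the open unit
    interval is \<open>{R<..}\<close>; they differ in one radius.\<close>
  proof (rule nn_integral_cong_AE, use AE_lborel_singleton[of R] in eventually_elim)
    fix r assume "r \<noteq> R"
    thus "ennreal (2 * pi * r) * (if R \<le> r then ennreal (k * r powr (- \<alpha>) / (1 + k * r powr (- \<alpha>))) else 0) * indicator {0..} r =
      ennreal (f r) * indicator {R<..} r"
      using R k den[of r "- \<alpha>"] by (auto simp: f_def indicator_def less_imp_le simp flip: ennreal_mult)
  qed
  finally show ?thesis using * by (simp add: D_def w_def[abs_def])
qed

section \<open>Euler's integral for the hypergeometric function\<close>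

text \<open>The set is star-shaped about \<open>0\<close>: if \<open>t *\<^sub>R z\<close> with
  \<open>0 < t\<close> and \<open>t \<le> 1\<close> lies on the cut, then so does \<open>z\<close>.
  The identity theorem asks for both properties.\<close>

lemma slit_plane_open_connected:
  "open (- complex_of_real ` {1..})" "connected (- complex_of_real ` {1..})"
proof -
  have "closed (complex_of_real ` {1..})"
    by (intro closed_injective_linear_image) (auto simp: inj_on_def bounded_linear.linear bounded_linear_of_real)
  thus "open (- complex_of_real ` {1..})" by (rule open_Compl)
  have "closed_segment 0 z \<subseteq> - complex_of_real ` {1..}" if "z \<notin> complex_of_real ` {1..}" for z
  proof
    fix w assume "w \<in> closed_segment 0 z"
    then obtain t where t: "0 \<le> t" "t \<le> 1" "w = t *\<^sub>R z" by (auto simp: in_segment)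
    show "w \<in> - complex_of_real ` {1..}"
    proof
      assume "w \<in> complex_of_real ` {1..}"
      then obtain x where x: "1 \<le> x" "t *\<^sub>R z = of_real x" using t by auto
      hence "t > 0" using t by (cases "t = 0") auto
      hence "z = of_real (x / t)" using x by (simp add: scaleR_conv_of_real field_simps)
      moreover have "1 \<le> x / t" using x t \<open>0 < t\<close> by (simp add: field_simps)
      ultimately show False
        using that imageI[of "x / t" "{1..}" complex_of_real] by simp
    qed
  qed
  hence "starlike (- complex_of_real ` {1..})"
    unfolding starlike_def by (intro bexI[of _ 0]) auto
  thus "connected (- complex_of_real ` {1..})" by (rule starlike_imp_connected)
qed

lemma powr_unit_interval_le_1:
  fixes u s :: real
  assumes "0 < s" "u \<in> {0..1}"
  shows "u powr s \<le> 1"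
  using powr_mono2[of s u 1] assms by simp

text \<open>
  For \<open>s = 1 / b\<close> this is the integral of \<open>b * t powr (b - 1) / (1 - z * t)\<close> over the unit interval; the
  substitution \<open>t = u powr s\<close> removes its singularity at \<open>0\<close>.
\<close>

definition euler_integral :: "real \<Rightarrow> complex \<Rightarrow> complex" where
  "euler_integral s z = integral {0..1} (\<lambda>u. 1 / (1 - z * of_real (u powr s)))"

text \<open>A zero would force \<open>z = 1 / u powr s\<close>, which is real and at least
  \<open>1\<close>, hence on the cut.\<close>

lemma euler_integral_denominator:
  assumes "z \<notin> complex_of_real ` {1..}" "0 < s" "u \<in> {0..1}"
  shows "1 - z * complex_of_real (u powr s) \<noteq> 0"
proof
  assume *: "1 - z * complex_of_real (u powr s) = 0"
  have "u powr s \<le> 1" using assms by (intro powr_unit_interval_le_1)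
  moreover have pos: "0 < u powr s" using * assms by (cases "u = 0") auto
  ultimately have "1 / u powr s \<in> {1..}" by simp
  moreover have "z = of_real (1 / u powr s)"
    using * pos by (simp add: field_simps)
  ultimately show False using assms(1) by blast
qed

text \<open>A positive constant exponent admits the base \<open>0\<close>, which occurs at the left
  end of the unit interval.\<close>

lemma continuous_on_powr_unit [continuous_intros]:
  assumes "0 < s" "continuous_on A f" "\<And>x. x \<in> A \<Longrightarrow> 0 \<le> f x"
  shows "continuous_on A (\<lambda>x. f x powr s :: real)"
  using assms by (intro continuous_on_powr' continuous_intros) auto

lemma euler_integral_holomorphic:
  assumes s: "0 < s"
  shows "euler_integral s holomorphic_on (- complex_of_real ` {1..})"
proof -
  let ?D = "- complex_of_real ` {1..}"
  \<comment> \<open>Differentiation under the integral sign is carried out on discs because the rule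
    wants a convex domain, which the slit plane is not.\<close>
  have "euler_integral s holomorphic_on ball z r" if "ball z r \<subseteq> ?D" for z r
    unfolding euler_integral_def[abs_def] box_real(2)[symmetric]
  proof (rule leibniz_rule_holomorphic)
    have den: "1 - w * complex_of_real (u powr s) \<noteq> 0" if "w \<in> ball z r" "u \<in> {0..1}" for w u
      using euler_integral_denominator[OF _ s that(2), of w] that(1) \<open>ball z r \<subseteq> ?D\<close> by blast
    show "((\<lambda>w. 1 / (1 - w * of_real (u powr s))) has_field_derivative
        of_real (u powr s) / (1 - w * of_real (u powr s))\<^sup>2) (at w within ball z r)"
      if "w \<in> ball z r" "u \<in> cbox 0 1" for w u
      using den[of w u] that by (auto intro!: derivative_eq_intros simp: power2_eq_square)
    show "(\<lambda>u. 1 / (1 - w * of_real (u powr s))) integrable_on cbox 0 1" if "w \<in> ball z r" for w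
      using den[OF that] s by (intro integrable_continuous continuous_intros) auto
    show "continuous_on (ball z r \<times> cbox 0 1) (\<lambda>(w, u). complex_of_real (u powr s) / (1 - w * of_real (u powr s))\<^sup>2)"
      using den s unfolding case_prod_unfold by (intro continuous_intros) auto
  qed auto
  moreover have "\<exists>r>0. ball z r \<subseteq> ?D" if "z \<in> ?D" for z
    using slit_plane_open_connected(1) that unfolding open_contains_ball by blast
  ultimately have "euler_integral s analytic_on ?D"
    unfolding analytic_on_def by blast
  thus ?thesis by (rule analytic_imp_holomorphic)
qed

text \<open>The coefficient \<open>b / (b + real n)\<close> is the integral of
  \<open>u powr (real n / b)\<close> over the unit interval. Integrating the geometric series term
  by term gives the claim; it converges uniformly, dominated by the powers of
  \<open>norm z\<close>.\<close>

lemma eval_hypergeo_eq_euler_integral: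
  assumes b: "0 < b" and z: "norm z < 1"
  shows "eval_fps (fps_hypergeo [1, complex_of_real b] [complex_of_real (b + 1)] 1) z = euler_integral (1 / b) z"
proof -
  let ?c = "\<lambda>n. complex_of_real (b / (b + real n))"
  \<comment> \<open>The Pochhammer symbol of the parameter \<open>1\<close> cancels the factorial,
    and the quotient of the other two telescopes because they are shifted by one.\<close>
  have coeff: "fps_hypergeo [1, complex_of_real b] [complex_of_real (b + 1)] 1 $ n = ?c n" for n
  proof -
    have pos: "0 < pochhammer (b + 1) n" using b by (intro pochhammer_pos) auto
    have "b * pochhammer (b + 1) n = (b + real n) * pochhammer b n"
      using pochhammer_rec[of b n] pochhammer_rec'[of b n] by simp
    hence "pochhammer b n / pochhammer (b + 1) n = b / (b + real n)"
      using pos b by (simp add: frac_eq_eq mult.commute)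
    hence "pochhammer (of_real b) n / pochhammer (complex_of_real (b + 1)) n = ?c n"
      by (simp only: pochhammer_of_real flip: of_real_divide)
    thus ?thesis by (simp add: pochhammer_fact[symmetric])
  qed
  have powint: "((\<lambda>u. z ^ n * of_real (u powr (1 / b)) ^ n) has_integral (?c n * z ^ n)) {0..1}" for n
  proof -
    have "0 \<le> real n / b" using b by simp
    hence "-1 < real n / b" by linarith
    hence "((\<lambda>u. u powr (real n / b)) has_integral (1 / (real n / b + 1))) {0..1}"
      using has_integral_powr_from_0[of "real n / b" 1] by simp
    hence "((\<lambda>u. complex_of_real (u powr (real n / b))) has_integral of_real (1 / (real n / b + 1))) {0..1}"
      by (rule has_integral_of_real)
    hence "((\<lambda>u. z ^ n * of_real (u powr (real n / b))) has_integral (z ^ n * of_real (1 / (real n / b + 1)))) {0..1}"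
      by (rule has_integral_mult_right)
    moreover have "1 / (real n / b + 1) = b / (b + real n)"
      using b by (simp add: field_simps)
    \<comment> \<open>At \<open>u = 0\<close> and \<open>n = 0\<close> the left side is
      \<open>1\<close> but \<open>0 powr 0\<close> is \<open>0\<close>, so this point is
      removed.\<close>
    moreover have "(u powr (1 / b)) ^ n = u powr (real n / b)" if "u \<in> {0..1} - {0}" for u
      using that by (simp add: powr_power)
    ultimately show ?thesis
      by (subst has_integral_spike_finite_eq[of "{0}"]) (auto simp: mult.commute simp flip: of_real_power)
  qed
  have unif: "uniform_limit {0..1} (\<lambda>n u. \<Sum>k<n. (z * of_real (u powr (1 / b))) ^ k)
      (\<lambda>u. \<Sum>k. (z * of_real (u powr (1 / b))) ^ k) sequentially"
  proof (rule Weierstrass_m_test)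
    show "norm ((z * of_real (u powr (1 / b))) ^ k) \<le> norm z ^ k" if "u \<in> {0..1}" for k u
      using that b unfolding norm_power
      by (intro power_mono) (auto simp: norm_mult powr_unit_interval_le_1 mult_left_le)
    show "summable (\<lambda>k. norm z ^ k)" using z by (simp add: summable_geometric)
  qed
  have geo: "(\<Sum>k. (z * of_real (u powr (1 / b))) ^ k) = 1 / (1 - z * of_real (u powr (1 / b)))" if "u \<in> {0..1}" for u
  proof (rule suminf_geometric)
    have "norm (z * of_real (u powr (1 / b))) \<le> norm z"
      using that b by (auto simp: norm_mult powr_unit_interval_le_1 mult_left_le)
    thus "norm (z * of_real (u powr (1 / b))) < 1" using z by simp
  qed
  obtain I J where IJ: "\<And>n. ((\<lambda>u. \<Sum>k<n. (z * of_real (u powr (1 / b))) ^ k) has_integral I n) {0..1}"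
      "((\<lambda>u. \<Sum>k. (z * of_real (u powr (1 / b))) ^ k) has_integral J) {0..1}" "I \<longlonglongrightarrow> J"
    by (rule uniform_limit_integral[OF unif]) (use b in \<open>auto intro!: continuous_intros\<close>)
  have "((\<lambda>u. \<Sum>k<n. (z * of_real (u powr (1 / b))) ^ k) has_integral (\<Sum>k<n. ?c k * z ^ k)) {0..1}" for n
    unfolding power_mult_distrib by (intro has_integral_sum powint) auto
  hence "I = (\<lambda>n. \<Sum>k<n. ?c k * z ^ k)"
    using IJ(1) has_integral_unique by blast
  hence "(\<lambda>k. ?c k * z ^ k) sums J"
    using IJ(3) by (simp add: sums_def)
  moreover have "J = euler_integral (1 / b) z"
    using IJ(2) geo unfolding euler_integral_def
    by (metis (no_types, lifting) has_integral_cong integral_unique)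
  ultimately show ?thesis
    unfolding eval_fps_def coeff by (simp only: sums_iff)
qed

text \<open>\<open>euler_integral\<close> witnesses that the choice in \<open>hyp2F1\<close> is
  possible. The chosen function has the same power series on the unit disc, so the two agree on the
  slit plane by the identity theorem.\<close>

lemma hyp2F1_1_eq_euler_integral:
  assumes b: "0 < b" and z: "z \<notin> complex_of_real ` {1..}"
  shows "hyp2F1 1 (of_real b) (of_real (b + 1)) z = euler_integral (1 / b) z"
proof -
  let ?D = "- complex_of_real ` {1..}"
  let ?P = "\<lambda>F. F holomorphic_on ?D \<and>
      (\<forall>z\<in>ball 0 1. F z = eval_fps (fps_hypergeo [1, complex_of_real b] [complex_of_real (b + 1)] 1) z)"
  have E: "?P (euler_integral (1 / b))"
    using b by (auto simp: euler_integral_holomorphic eval_hypergeo_eq_euler_integral simp del: of_real_add)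
  have F: "?P (hyp2F1 1 (of_real b) (of_real (b + 1)))"
    unfolding hyp2F1_def by (rule someI[where P = ?P, OF E])
  have sub: "ball 0 1 \<subseteq> ?D" by auto
  show ?thesis
    by (rule analytic_continuation_open[where s = "ball 0 1" and s' = ?D
          and f = "hyp2F1 1 (of_real b) (of_real (b + 1))" and g = "euler_integral (1 / b)"])
       (use slit_plane_open_connected sub E F z in auto)
qed

text \<open>With \<open>b = (\<alpha> - 2) / \<alpha>\<close> the third parameter is
  \<open>b + 1\<close>, and \<open>1 / b\<close> is the exponent found for the integral outside a
  disc. The argument is not positive, hence off the cut, and the integrand is real.\<close>

lemma G_fun_eq_integral:
  assumes "2 < \<alpha>"
  shows "G_fun y \<alpha> = y powr (2 - \<alpha>) * integral {0..1} (\<lambda>u. 1 / (1 + y powr (- \<alpha>) * u powr (\<alpha> / (\<alpha> - 2))))"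
proof -
  let ?b = "(\<alpha> - 2) / \<alpha>" and ?x = "y powr (- \<alpha>)"
  have b: "0 < ?b" and b1: "(2 * \<alpha> - 2) / \<alpha> = ?b + 1" and s: "1 / ?b = \<alpha> / (\<alpha> - 2)"
    using assms by (auto simp: field_simps)
  have "complex_of_real (- ?x) \<notin> complex_of_real ` {1..}"
  proof
    assume "complex_of_real (- ?x) \<in> complex_of_real ` {1..}"
    hence "1 \<le> - ?x" by (metis (no_types) atLeast_iff imageE of_real_eq_iff)
    thus False using powr_ge_zero[of y "- \<alpha>"] by linarith
  qed
  from hyp2F1_1_eq_euler_integral[OF b this]
  have "hyp2F1 1 (of_real ?b) (of_real ((2 * \<alpha> - 2) / \<alpha>)) (of_real (- ?x)) =
      integral {0..1} (\<lambda>u. complex_of_real (1 / (1 + ?x * u powr (\<alpha> / (\<alpha> - 2)))))"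
    unfolding b1 s euler_integral_def by simp
  also have "\<dots> = of_real (integral {0..1} (\<lambda>u. 1 / (1 + ?x * u powr (\<alpha> / (\<alpha> - 2)))))"
  proof (rule integral_unique, rule has_integral_of_real, rule integrable_integral, rule integrable_continuous_real)
    have "1 + ?x * u powr (\<alpha> / (\<alpha> - 2)) \<noteq> 0" for u
      by (metis add_nonneg_pos add.commute less_irrefl mult_nonneg_nonneg powr_ge_zero zero_less_one)
    thus "continuous_on {0..1} (\<lambda>u. 1 / (1 + ?x * u powr (\<alpha> / (\<alpha> - 2))))"
      using assms by (auto intro!: continuous_intros)
  qed
  finally show ?thesis by (simp add: G_fun_def)
qed

section \<open>Outage and the Laplace transforms of the interferences\<close>

lemma config_sum_cmult: "c * config_sum f \<phi> = config_sum (\<lambda>x m. c * f x m) \<phi>"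
  unfolding config_sum_eq by (subst ennreal_suminf_cmult[symmetric], rule suminf_cong) simp

text \<open>The noise keeps the denominator positive, so division by \<open>0\<close> does not
  arise. For infinite interference the ratio is \<open>0\<close> and both sides hold; a negative
  gain is truncated to \<open>0\<close> by \<open>ennreal\<close> on both sides.\<close>

lemma SINR_le_iff:
  assumes "0 < \<rho>" "0 < noise" "0 < \<tau>"
  shows "SINR \<rho> noise h I J \<le> ennreal \<tau> \<longleftrightarrow> ennreal h \<le> ennreal (\<tau> / \<rho>) * (I + J + ennreal noise)"
proof (cases "I + J + ennreal noise" rule: ennreal_cases)
  case top
  have "SINR \<rho> noise h I J = 0"
    unfolding SINR_def top by simp
  moreover have "ennreal (\<tau> / \<rho>) * (I + J + ennreal noise) = top"
    unfolding top using assms by (simp add: ennreal_mult_top)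
  ultimately show ?thesis by simp
next
  case (real d)
  have "ennreal noise \<le> ennreal d"
    unfolding real(2)[symmetric] by simp
  hence d: "0 < d" using assms real(1) by (simp add: ennreal_le_iff)
  have "ennreal h \<le> ennreal (\<tau> / \<rho> * d) \<longleftrightarrow> ennreal (\<rho> * h) / ennreal d \<le> ennreal \<tau>"
  proof (cases "0 \<le> h")
    case True
    thus ?thesis using assms d by (simp add: divide_ennreal ennreal_le_iff field_simps)
  next
    case False
    thus ?thesis using assms by (simp add: ennreal_neg mult_le_0_iff)
  qed
  moreover have "ennreal (\<tau> / \<rho> * d) = ennreal (\<tau> / \<rho>) * ennreal d"
    using assms d by (intro ennreal_mult) auto
  ultimately show ?thesis unfolding SINR_def real(2) by simp
qed

context prob_space
begin

text \<open>\<open>exp (- h)\<close> is uniform on the unit interval, so it falls below an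
  independent level \<open>w\<close> with probability \<open>w\<close>. Averaging over the level
  replaces conditioning on the interferences.\<close>

lemma emeasure_exponential_less_indep:
  assumes h: "distributed M lborel h (\<lambda>x. ennreal (exponential_density 1 x))"
    and W: "\<And>\<omega>. 0 \<le> W \<omega>" "\<And>\<omega>. W \<omega> \<le> 1"
    and indep: "indep_var borel (\<lambda>\<omega>. enn2real (nexp (ennreal (h \<omega>)))) borel W"
  shows "emeasure M {\<omega> \<in> space M. enn2real (nexp (ennreal (h \<omega>))) < W \<omega>} = (\<integral>\<^sup>+\<omega>. ennreal (W \<omega>) \<partial>M)"
proof -
  let ?Y = "\<lambda>\<omega>. enn2real (nexp (ennreal (h \<omega>)))"
  have [measurable]: "?Y \<in> borel_measurable M" "W \<in> borel_measurable M"
    and joint: "distr M (borel \<Otimes>\<^sub>M borel) (\<lambda>\<omega>. (?Y \<omega>, W \<omega>)) = distr M borel ?Y \<Otimes>\<^sub>M distr M borel W"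
    using indep unfolding indep_var_distribution_eq by auto
  interpret Y: prob_space "distr M borel ?Y" by (rule prob_space_distr) simp
  interpret W: prob_space "distr M borel W" by (rule prob_space_distr) simp
  interpret P: pair_sigma_finite "distr M borel ?Y" "distr M borel W" ..
  have less: "emeasure M {\<omega> \<in> space M. ?Y \<omega> < c} = ennreal c" if "0 \<le> c" "c \<le> 1" for c
  proof (cases "c = 0")
    case True
    thus ?thesis by (simp add: leD[OF enn2real_nonneg])
  next
    case False
    hence c: "0 < c" using that by simp
    have "?Y \<omega> < c \<longleftrightarrow> - ln c < h \<omega>" for \<omega>
    proof (cases "0 \<le> h \<omega>")
      case True
      have "exp (- h \<omega>) < c \<longleftrightarrow> - h \<omega> < ln c"
        using c by (metis exp_less_cancel_iff exp_ln)
      thus ?thesis using True by auto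
    next
      \<comment> \<open>A negative gain is truncated, which makes the left variable
        \<open>1\<close>; both sides are then false because \<open>c \<le> 1\<close>.\<close>
      case False
      moreover have "ln c \<le> 0" using c that by simp
      ultimately show ?thesis using that by (simp add: ennreal_neg)
    qed
    hence "emeasure M {\<omega> \<in> space M. ?Y \<omega> < c} = ennreal (prob {\<omega> \<in> space M. - ln c < h \<omega>})"
      by (simp add: emeasure_eq_measure)
    also have "prob {\<omega> \<in> space M. - ln c < h \<omega>} = exp (- (- ln c) * 1)"
      using h c that by (intro exponential_distributedD_gt) auto
    finally show ?thesis using c by simp
  qed
  have [measurable]: "{p::real \<times> real. fst p < snd p} \<in> sets (borel \<Otimes>\<^sub>M borel)"
    unfolding borel_prod by (intro borel_open open_Collect_less continuous_intros)
  have "emeasure M {\<omega> \<in> space M. ?Y \<omega> < W \<omega>} =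
      emeasure (distr M (borel \<Otimes>\<^sub>M borel) (\<lambda>\<omega>. (?Y \<omega>, W \<omega>))) {p. fst p < snd p}"
    by (subst emeasure_distr) (auto intro!: arg_cong[where f = "emeasure M"])
  also have "\<dots> = (\<integral>\<^sup>+w. emeasure (distr M borel ?Y) ((\<lambda>y. (y, w)) -` {p. fst p < snd p}) \<partial>distr M borel W)"
    unfolding joint
    by (rule P.emeasure_pair_measure_alt2) simp
  also have "\<dots> = (\<integral>\<^sup>+w. emeasure M {\<omega> \<in> space M. ?Y \<omega> < w} \<partial>distr M borel W)"
    by (intro nn_integral_cong) (auto simp: emeasure_distr intro!: arg_cong[where f = "emeasure M"])
  also have "\<dots> = (\<integral>\<^sup>+\<omega>. emeasure M {\<omega>' \<in> space M. ?Y \<omega>' < W \<omega>} \<partial>M)"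
    by (rule nn_integral_distr) measurable
  finally show ?thesis by (simp add: less W)
qed

lemma laplace_D2D_interference:
  assumes PPP: "marked_PPP \<mu> fading_law \<Psi>" and "2 < \<beta>" "0 \<le> P" "0 \<le> s"
  shows "(\<integral>\<^sup>+\<omega>. nexp (ennreal s * D2D_interference P \<beta> (\<Psi> \<omega>)) \<partial>M) =
         nexp (ennreal \<mu> * ennreal (2 * pi\<^sup>2 / (\<beta> * sin (2 * pi / \<beta>)) * (s * P) powr (2 / \<beta>)))"
proof -
  have "(\<integral>\<^sup>+\<omega>. nexp (ennreal s * D2D_interference P \<beta> (\<Psi> \<omega>)) \<partial>M) =
      (\<integral>\<^sup>+\<omega>. nexp (config_sum (\<lambda>x h. ennreal (s * P * h * norm x powr (- \<beta>))) (\<Psi> \<omega>)) \<partial>M)"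
    using \<open>0 \<le> s\<close> by (simp add: D2D_interference_def config_sum_cmult mult.assoc flip: ennreal_mult')
  also have "\<dots> = nexp (ennreal \<mu> * (\<integral>\<^sup>+x. \<integral>\<^sup>+h. (1 - nexp (ennreal (s * P * h * norm (x::plane) powr (- \<beta>)))) \<partial>fading_law \<partial>lborel))"
    by (rule marked_PPP_laplace_functional[OF PPP prob_space_fading_law]) measurable
  finally show ?thesis
    using assms by (simp add: nn_integral_fading_path_loss)
qed

end

text \<open>Supplies the sign conditions for splitting products under
  \<open>ennreal\<close>.\<close>

lemma G_fun_nonneg:
  assumes "2 < \<alpha>"
  shows "0 \<le> G_fun y \<alpha>"
proof -
  let ?f = "\<lambda>u. 1 / (1 + y powr (- \<alpha>) * u powr (\<alpha> / (\<alpha> - 2)))"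
  have "0 \<le> integral {0..1} ?f"
    by (cases "?f integrable_on {0..1}")
       (auto simp: not_integrable_integral add_nonneg_nonneg intro!: Henstock_Kurzweil_Integration.integral_nonneg)
  thus ?thesis unfolding G_fun_eq_integral[OF assms] by simp
qed

lemma nn_integral_cellular_interference:
  fixes L :: "real measure"
  assumes \<alpha>: "2 < \<alpha>" and pos: "0 < s" "0 < \<gamma>"
    and L: "prob_space L" "sets L = sets borel" "AE P in L. 0 < P"
    and c: "0 < c"
  defines "y \<equiv> (1 / (\<gamma> * s)) powr (1 / \<alpha>) * c"
  shows "(\<integral>\<^sup>+x. \<integral>\<^sup>+m. (1 - nexp (ennreal s * (if norm (x::plane) \<ge> (fst m / \<gamma>) powr (1 / \<alpha>) * c
            then cellular_received \<alpha> x m else 0))) \<partial>(L \<Otimes>\<^sub>M fading_law) \<partial>lborel) =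
         ennreal (2 * pi / (\<alpha> - 2) * G_fun y \<alpha> * s powr (2 / \<alpha>)) * (\<integral>\<^sup>+P. ennreal (P powr (2 / \<alpha>)) \<partial>L)"
proof -
  note [measurable_cong] = L(2)
  interpret L: prob_space L by fact
  interpret F: prob_space fading_law by (rule prob_space_fading_law)
  interpret pair_sigma_finite "lborel :: plane measure" L ..
  have y: "0 < y" using pos c by (simp add: y_def)
  let ?R = "\<lambda>P. (P / \<gamma>) powr (1 / \<alpha>) * c"
  let ?f = "\<lambda>x P h. 1 - nexp (ennreal s * (if norm (x::plane) \<ge> ?R P then ennreal (P * h * norm x powr (- \<alpha>)) else 0))"
  have inner: "(\<integral>\<^sup>+x. \<integral>\<^sup>+h. ?f x P h \<partial>fading_law \<partial>lborel) =
      ennreal (2 * pi / (\<alpha> - 2) * G_fun y \<alpha> * s powr (2 / \<alpha>)) * ennreal (P powr (2 / \<alpha>))" if P: "0 < P" for P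
  proof -
    define k where "k = s * P"
    have k: "0 < k" using P pos by (simp add: k_def)
    \<comment> \<open>\<open>y\<close> is the protection radius in units of
      \<open>k powr (1 / \<alpha>)\<close> and is free of \<open>P\<close>. By \<open>a1\<close> the
      parameter of the Euler integral is then free of \<open>P\<close> too, and \<open>a2\<close>
      puts the whole dependence into the prefactor.\<close>
    have R: "?R P = y * k powr (1 / \<alpha>)"
    proof -
      have "P / \<gamma> = 1 / (\<gamma> * s) * k" using pos by (simp add: k_def)
      hence "(P / \<gamma>) powr (1 / \<alpha>) = (1 / (\<gamma> * s)) powr (1 / \<alpha>) * k powr (1 / \<alpha>)"
        using pos k by (simp only: powr_mult)
      thus ?thesis by (simp add: y_def mult_ac)
    qed
    have Rpos: "0 < ?R P" unfolding R using y k by simp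
    have a1: "k * ?R P powr (- \<alpha>) = y powr (- \<alpha>)"
      unfolding R using y k \<alpha> by (simp add: powr_mult powr_powr powr_minus field_simps)
    have a2: "?R P powr (2 - \<alpha>) * k = y powr (2 - \<alpha>) * k powr (2 / \<alpha>)"
    proof -
      have "k powr (1 / \<alpha> * (2 - \<alpha>)) * k powr 1 = k powr (2 / \<alpha>)"
        unfolding powr_add[symmetric] using \<alpha> by (simp add: field_simps)
      thus ?thesis unfolding R using y k by (simp add: powr_mult powr_powr mult.assoc)
    qed
    have "(\<integral>\<^sup>+h. ?f x P h \<partial>fading_law) =
        (if ?R P \<le> norm x then ennreal (k * norm x powr (- \<alpha>) / (1 + k * norm x powr (- \<alpha>))) else 0)" for x
    proof (cases "?R P \<le> norm x")
      case True
      have "(\<integral>\<^sup>+h. ?f x P h \<partial>fading_law) = (\<integral>\<^sup>+h. (1 - nexp (ennreal ((k * norm x powr (- \<alpha>)) * h))) \<partial>fading_law)"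
        using True pos by (simp add: k_def mult_ac flip: ennreal_mult')
      also have "\<dots> = ennreal (k * norm x powr (- \<alpha>) / (1 + k * norm x powr (- \<alpha>)))"
        by (rule nn_integral_fading_law_one_minus_nexp) (use k in simp)
      finally show ?thesis using True by simp
    qed simp
    hence "(\<integral>\<^sup>+x. \<integral>\<^sup>+h. ?f x P h \<partial>fading_law \<partial>lborel) =
        (\<integral>\<^sup>+x. (if ?R P \<le> norm (x::plane) then ennreal (k * norm x powr (- \<alpha>) / (1 + k * norm x powr (- \<alpha>))) else 0) \<partial>lborel)"
      by simp
    also have "\<dots> = ennreal (2 * pi / (\<alpha> - 2) * ?R P powr (2 - \<alpha>) * k *
        integral {0..1} (\<lambda>u. 1 / (1 + k * ?R P powr (- \<alpha>) * u powr (\<alpha> / (\<alpha> - 2)))))"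
      by (rule nn_integral_path_loss_outside_disc[OF \<alpha> Rpos]) (use k in simp)
    also have "2 * pi / (\<alpha> - 2) * ?R P powr (2 - \<alpha>) * k *
        integral {0..1} (\<lambda>u. 1 / (1 + k * ?R P powr (- \<alpha>) * u powr (\<alpha> / (\<alpha> - 2)))) =
        2 * pi / (\<alpha> - 2) * (?R P powr (2 - \<alpha>) * k) *
        integral {0..1} (\<lambda>u. 1 / (1 + (k * ?R P powr (- \<alpha>)) * u powr (\<alpha> / (\<alpha> - 2))))"
      by (simp only: mult.assoc)
    also have "\<dots> = 2 * pi / (\<alpha> - 2) * G_fun y \<alpha> * k powr (2 / \<alpha>)"
      unfolding a1 a2 G_fun_eq_integral[OF \<alpha>] by (simp only: mult_ac)
    also have "k powr (2 / \<alpha>) = s powr (2 / \<alpha>) * P powr (2 / \<alpha>)"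
      using pos P by (simp add: k_def powr_mult)
    finally show ?thesis
      using \<alpha> G_fun_nonneg[OF \<alpha>, of y] by (simp add: mult.assoc flip: ennreal_mult)
  qed
  have "(\<integral>\<^sup>+x. \<integral>\<^sup>+m. (1 - nexp (ennreal s * (if norm (x::plane) \<ge> ?R (fst m)
            then cellular_received \<alpha> x m else 0))) \<partial>(L \<Otimes>\<^sub>M fading_law) \<partial>lborel) =
        (\<integral>\<^sup>+x. \<integral>\<^sup>+P. \<integral>\<^sup>+h. ?f x P h \<partial>fading_law \<partial>L \<partial>lborel)"
  proof (intro nn_integral_cong)
    fix x :: plane
    have "(\<lambda>m. ?f x (fst m) (snd m)) \<in> borel_measurable (L \<Otimes>\<^sub>M fading_law)"
      by measurable
    from F.nn_integral_fst[OF this]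
    show "(\<integral>\<^sup>+m. (1 - nexp (ennreal s * (if norm x \<ge> ?R (fst m) then cellular_received \<alpha> x m else 0))) \<partial>(L \<Otimes>\<^sub>M fading_law)) =
        (\<integral>\<^sup>+P. \<integral>\<^sup>+h. ?f x P h \<partial>fading_law \<partial>L)"
      by (simp add: cellular_received_def case_prod_unfold cong: if_cong)
  qed
  \<comment> \<open>The radius depends on the power, so the plane is integrated for each fixed power
    and the power comes last; it is positive almost surely, as \<open>inner\<close>
    requires.\<close>
  also have "\<dots> = (\<integral>\<^sup>+P. \<integral>\<^sup>+x. \<integral>\<^sup>+h. ?f x P h \<partial>fading_law \<partial>lborel \<partial>L)"
    by (rule Fubini'[symmetric]) measurable
  also have "\<dots> = (\<integral>\<^sup>+P. ennreal (2 * pi / (\<alpha> - 2) * G_fun y \<alpha> * s powr (2 / \<alpha>)) * ennreal (P powr (2 / \<alpha>)) \<partial>L)"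
    by (rule nn_integral_cong_AE, use L(3) in eventually_elim) (rule inner)
  also have "\<dots> = ennreal (2 * pi / (\<alpha> - 2) * G_fun y \<alpha> * s powr (2 / \<alpha>)) * (\<integral>\<^sup>+P. ennreal (P powr (2 / \<alpha>)) \<partial>L)"
    by (rule nn_integral_cmult) measurable
  finally show ?thesis .
qed

lemma (in prob_space) laplace_cellular_interference:
  assumes PPP: "marked_PPP \<mu> (L \<Otimes>\<^sub>M fading_law) \<Psi>"
    and \<alpha>: "2 < \<alpha>" and pos: "0 < s" "0 < \<gamma>"
    and L: "prob_space L" "sets L = sets borel" "AE P in L. 0 < P"
  shows "(\<integral>\<^sup>+\<omega>. nexp (ennreal s * cellular_interference \<gamma> \<alpha> (\<Psi> \<omega>)) \<partial>M) =
         nexp (ennreal \<mu> * (ennreal (2 * pi / (\<alpha> - 2) *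
           G_fun ((1 / (\<gamma> * s)) powr (1 / \<alpha>) * Gamma (1 + 1 / \<alpha>)) \<alpha> * s powr (2 / \<alpha>)) *
           (\<integral>\<^sup>+P. ennreal (P powr (2 / \<alpha>)) \<partial>L)))"
proof -
  note [measurable_cong] = L(2)
  interpret L: prob_space L by fact
  interpret F: prob_space fading_law by (rule prob_space_fading_law)
  interpret LF: pair_prob_space L fading_law ..
  have c: "0 < Gamma (1 + 1 / \<alpha>)"
    using \<alpha> by (intro Gamma_real_pos add_pos_pos) auto
  have "(\<integral>\<^sup>+\<omega>. nexp (ennreal s * cellular_interference \<gamma> \<alpha> (\<Psi> \<omega>)) \<partial>M) =
      (\<integral>\<^sup>+\<omega>. nexp (config_sum (\<lambda>x m. ennreal s * (if norm x \<ge> (fst m / \<gamma>) powr (1 / \<alpha>) * Gamma (1 + 1 / \<alpha>)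
            then cellular_received \<alpha> x m else 0)) (\<Psi> \<omega>)) \<partial>M)"
    by (simp add: cellular_interference_def config_sum_cmult cellular_received_def case_prod_unfold cong: if_cong)
  also have "\<dots> = nexp (ennreal \<mu> * (\<integral>\<^sup>+x. \<integral>\<^sup>+m. (1 - nexp (ennreal s * (if norm x \<ge> (fst m / \<gamma>) powr (1 / \<alpha>) * Gamma (1 + 1 / \<alpha>)
            then cellular_received \<alpha> x m else 0))) \<partial>(L \<Otimes>\<^sub>M fading_law) \<partial>lborel))"
    unfolding cellular_received_def case_prod_unfold
    by (rule marked_PPP_laplace_functional[OF PPP LF.prob_space_axioms]) measurable
  finally show ?thesis
    unfolding nn_integral_cellular_interference[OF \<alpha> pos L c] .
qed

section \<open>Moments of the transmit powers\<close>

lemma tendsto_quadratic_times_gaussian: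
  fixes c d :: real
  assumes "0 < c"
  shows "((\<lambda>r. - ((r\<^sup>2 + d) * exp (- c * r\<^sup>2))) \<longlongrightarrow> 0) at_top"
proof -
  have "filterlim (\<lambda>r::real. c * r\<^sup>2) at_top at_top"
    using assms by (intro filterlim_tendsto_pos_mult_at_top[OF tendsto_const] filterlim_pow_at_top filterlim_ident) auto
  hence lim: "((\<lambda>r. (c * r\<^sup>2) ^ k / exp (c * r\<^sup>2)) \<longlongrightarrow> 0) at_top" for k
    by (rule filterlim_compose[OF tendsto_power_div_exp_0])
  have "((\<lambda>r. - (1 / c * ((c * r\<^sup>2) ^ 1 / exp (c * r\<^sup>2)) + d * ((c * r\<^sup>2) ^ 0 / exp (c * r\<^sup>2)))) \<longlongrightarrow> - (1 / c * 0 + d * 0)) at_top"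
    by (intro tendsto_intros lim)
  thus ?thesis using assms by (simp add: exp_minus field_simps)
qed

text \<open>For \<open>c\<close> equal to \<open>pi\<close> times the base station density this is
  the law of the distance to the nearest station, whose square is exponential of rate
  \<open>c\<close>. Integration by parts yields the antiderivative
  \<open>- ((r\<^sup>2 + 1 / c) * exp (- c * r\<^sup>2))\<close> of the second integrand.\<close>

lemma nn_integral_rayleigh_moment:
  assumes c: "0 < c"
  shows "(\<integral>\<^sup>+r. ennreal (2 * c * r * exp (- c * r\<^sup>2)) * indicator {0..} r \<partial>lborel) = 1"
    and "(\<integral>\<^sup>+r. ennreal (2 * c * r * exp (- c * r\<^sup>2) * r\<^sup>2) * indicator {0..} r \<partial>lborel) = ennreal (1 / c)"
proof -
  have "filterlim (\<lambda>r::real. c * r\<^sup>2) at_top at_top"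
    using c by (intro filterlim_tendsto_pos_mult_at_top[OF tendsto_const] filterlim_pow_at_top filterlim_ident) auto
  hence "((\<lambda>r. exp (- c * r\<^sup>2)) \<longlongrightarrow> 0) at_top"
    by (intro filterlim_compose[OF exp_at_bot]) (simp add: filterlim_uminus_at_bot)
  from tendsto_minus[OF this] have lim: "((\<lambda>r. - exp (- c * r\<^sup>2)) \<longlongrightarrow> 0) at_top" by simp
  have "(\<integral>\<^sup>+r. ennreal (2 * c * r * exp (- c * r\<^sup>2)) * indicator {0..} r \<partial>lborel) = ennreal (0 - (- exp (- c * 0\<^sup>2)))"
    using c by (intro nn_integral_FTC_atLeast lim) (auto intro!: derivative_eq_intros)
  thus "(\<integral>\<^sup>+r. ennreal (2 * c * r * exp (- c * r\<^sup>2)) * indicator {0..} r \<partial>lborel) = 1" by simp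
  have "(\<integral>\<^sup>+r. ennreal (2 * c * r * exp (- c * r\<^sup>2) * r\<^sup>2) * indicator {0..} r \<partial>lborel) =
      ennreal (0 - (- ((0\<^sup>2 + 1 / c) * exp (- c * 0\<^sup>2))))"
  proof (intro nn_integral_FTC_atLeast tendsto_quadratic_times_gaussian c)
    show "((\<lambda>r. - ((r\<^sup>2 + 1 / c) * exp (- c * r\<^sup>2))) has_real_derivative 2 * c * r * exp (- c * r\<^sup>2) * r\<^sup>2) (at r)" for r
      using c by (auto intro!: derivative_eq_intros simp: field_simps power2_eq_square)
  qed (use c in auto)
  thus "(\<integral>\<^sup>+r. ennreal (2 * c * r * exp (- c * r\<^sup>2) * r\<^sup>2) * indicator {0..} r \<partial>lborel) = ennreal (1 / c)" by simp
qed

text \<open>On the uplink \<open>(\<rho>\<^sub>b * r powr \<alpha>) powr (2 / \<alpha>)\<close>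
  equals \<open>\<rho>\<^sub>b powr (2 / \<alpha>) * r\<^sup>2\<close>, whose mean is
  \<open>\<rho>\<^sub>b powr (2 / \<alpha>) / (pi * lam)\<close>. The effective power is the
  constant with the same moment of order \<open>2 / \<alpha>\<close>, so one formula serves both
  channel types.\<close>

lemma cellular_power_law:
  fixes dl :: bool and P\<^sub>B lam \<rho>\<^sub>b \<alpha> :: real
  assumes pos: "0 < P\<^sub>B" "0 < lam" "0 < \<rho>\<^sub>b" "0 < \<alpha>"
  defines "L \<equiv> cellular_power_law dl P\<^sub>B lam \<rho>\<^sub>b \<alpha>"
  shows "sets L = sets borel" "prob_space L" "AE P in L. 0 < P"
    and "(\<integral>\<^sup>+P. ennreal (P powr (2 / \<alpha>)) \<partial>L) =
         ennreal ((if dl then P\<^sub>B else \<rho>\<^sub>b / (pi * lam) powr (\<alpha> / 2)) powr (2 / \<alpha>))"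
proof -
  define D where "D = density lborel
    (\<lambda>r. ennreal (if 0 < r then 2 * pi * lam * r * exp (- pi * lam * r\<^sup>2) else 0))"
  define c where "c = pi * lam"
  have c: "0 < c" using pos by (simp add: c_def)
  have L: "L = (if dl then return borel P\<^sub>B else distr D borel (\<lambda>r. \<rho>\<^sub>b * r powr \<alpha>))"
    by (simp add: L_def cellular_power_law_def user_power_law_def D_def)
  have [measurable_cong]: "sets D = sets borel" by (simp add: D_def)
  show "sets L = sets borel" by (simp add: L)
  have density: "ennreal (if 0 < r then 2 * pi * lam * r * exp (- pi * lam * r\<^sup>2) else 0) =
      ennreal (2 * c * r * exp (- c * r\<^sup>2)) * indicator {0..} r" for r
    by (auto simp: c_def indicator_def mult.assoc)
  have D: "emeasure D (space D) = 1"
    using nn_integral_rayleigh_moment(1)[OF c]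
    by (simp add: D_def emeasure_density density)
  interpret D: prob_space D by standard (rule D)
  show "prob_space L"
    by (simp add: L prob_space_return D.prob_space_distr)
  have "AE r in D. 0 < r"
    unfolding D_def by (subst AE_density) auto
  hence "AE r in D. 0 < \<rho>\<^sub>b * r powr \<alpha>"
    by eventually_elim (use pos in simp)
  hence "AE P in distr D borel (\<lambda>r. \<rho>\<^sub>b * r powr \<alpha>). 0 < P"
    by (subst AE_distr_iff) auto
  moreover have "AE P in return borel P\<^sub>B. 0 < P"
    using pos by (subst AE_return) auto
  ultimately show "AE P in L. 0 < P" unfolding L by (cases dl) simp_all
  show "(\<integral>\<^sup>+P. ennreal (P powr (2 / \<alpha>)) \<partial>L) =
         ennreal ((if dl then P\<^sub>B else \<rho>\<^sub>b / (pi * lam) powr (\<alpha> / 2)) powr (2 / \<alpha>))"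
  proof (cases dl)
    case True
    thus ?thesis by (simp add: L nn_integral_return)
  next
    case False
    have "(\<integral>\<^sup>+P. ennreal (P powr (2 / \<alpha>)) \<partial>L) = (\<integral>\<^sup>+r. ennreal ((\<rho>\<^sub>b * r powr \<alpha>) powr (2 / \<alpha>)) \<partial>D)"
      using False by (simp add: L nn_integral_distr)
    also have "\<dots> = (\<integral>\<^sup>+r. ennreal (2 * c * r * exp (- c * r\<^sup>2)) * indicator {0..} r * ennreal ((\<rho>\<^sub>b * r powr \<alpha>) powr (2 / \<alpha>)) \<partial>lborel)"
      unfolding D_def density by (subst nn_integral_density) auto
    also have "\<dots> = (\<integral>\<^sup>+r. ennreal (\<rho>\<^sub>b powr (2 / \<alpha>)) * (ennreal (2 * c * r * exp (- c * r\<^sup>2) * r\<^sup>2) * indicator {0..} r) \<partial>lborel)"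
    proof (intro nn_integral_cong)
      fix r :: real
      show "ennreal (2 * c * r * exp (- c * r\<^sup>2)) * indicator {0..} r * ennreal ((\<rho>\<^sub>b * r powr \<alpha>) powr (2 / \<alpha>)) =
          ennreal (\<rho>\<^sub>b powr (2 / \<alpha>)) * (ennreal (2 * c * r * exp (- c * r\<^sup>2) * r\<^sup>2) * indicator {0..} r)"
      proof (cases "0 \<le> r")
        case True
        have "(\<rho>\<^sub>b * r powr \<alpha>) powr (2 / \<alpha>) = \<rho>\<^sub>b powr (2 / \<alpha>) * r\<^sup>2"
          using True pos by (cases "r = 0") (auto simp: powr_mult powr_powr)
        thus ?thesis using True c by (simp add: mult_ac flip: ennreal_mult)
      qed simp
    qed
    also have "\<dots> = ennreal (\<rho>\<^sub>b powr (2 / \<alpha>)) * ennreal (1 / c)"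
      by (subst nn_integral_cmult, simp, simp only: nn_integral_rayleigh_moment(2)[OF c])
    also have "\<dots> = ennreal ((\<rho>\<^sub>b / (pi * lam) powr (\<alpha> / 2)) powr (2 / \<alpha>))"
      using pos c by (simp add: powr_divide powr_powr c_def flip: ennreal_mult)
    finally show ?thesis using False by simp
  qed
qed

theorem theorem1:
  fixes lam\<^sub>B lam\<^sub>U lam\<^sub>D P\<^sub>B \<rho>\<^sub>b \<rho>\<^sub>d noise \<gamma> d\<^sub>o \<alpha> \<beta> a \<tau> :: real
    and C\<^sub>D C\<^sub>U :: "'c set" and c\<^sub>d :: 'c and policy :: access_policy
    and P\<^sub>D q\<^sub>d q\<^sub>c\<^sub>D q\<^sub>c\<^sub>U p\<^sub>f p\<^sub>s Pbar K\<^sub>1 :: real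
    and cellular_law user_law :: "(real \<times> real) measure"
    and M\<^sub>f :: "'f measure" and \<Phi>\<^sub>f :: "'f \<Rightarrow> (real \<times> real) config"
    and M\<^sub>s :: "'s measure" and \<Phi>\<^sub>B :: "'s \<Rightarrow> ('c \<Rightarrow> real) config"
    and \<Phi>\<^sub>U :: "'s \<Rightarrow> (real \<times> real) config"
    and M :: "'w measure" and h\<^sub>o :: "'w \<Rightarrow> real"
    and \<Psi>\<^sub>B :: "'w \<Rightarrow> (real \<times> real) config" and \<Psi>\<^sub>D :: "'w \<Rightarrow> real config"
    and I\<^sub>B I\<^sub>D :: "'w \<Rightarrow> ennreal"
  assumes pos: "lam\<^sub>B > 0" "lam\<^sub>U > 0" "lam\<^sub>D > 0" "P\<^sub>B > 0" "\<rho>\<^sub>b > 0" "\<rho>\<^sub>d > 0" "noise > 0" "\<gamma> > 0"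
      "d\<^sub>o > 0" "\<alpha> > 2" "\<beta> > 2" "0 < a" "a \<le> 1" "\<tau> > 0"
    and channels: "finite C\<^sub>D" "finite C\<^sub>U" "C\<^sub>D \<inter> C\<^sub>U = {}" "c\<^sub>d \<in> C\<^sub>D \<union> C\<^sub>U"
    and P\<^sub>D: "P\<^sub>D = \<rho>\<^sub>d * d\<^sub>o powr \<beta>"
    and q\<^sub>d: "q\<^sub>d = access_prob policy lam\<^sub>U lam\<^sub>B (card (C\<^sub>D \<union> C\<^sub>U))"
    and q\<^sub>c\<^sub>D: "q\<^sub>c\<^sub>D = RSA_prob lam\<^sub>U lam\<^sub>B (card C\<^sub>D)"
    and q\<^sub>c\<^sub>U: "q\<^sub>c\<^sub>U = RSA_prob lam\<^sub>U lam\<^sub>B (card C\<^sub>U)"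
    and user_law: "user_law = user_power_law lam\<^sub>B \<rho>\<^sub>b \<alpha> \<Otimes>\<^sub>M fading_law"
    and cellular_law:
      "cellular_law = cellular_power_law (c\<^sub>d \<in> C\<^sub>D) P\<^sub>B lam\<^sub>B \<rho>\<^sub>b \<alpha> \<Otimes>\<^sub>M fading_law"
    \<comment> \<open>probability that the D2D channel is found free\<close>
    and "prob_space M\<^sub>f"
    and "prob_space.marked_PPP M\<^sub>f (q\<^sub>d * lam\<^sub>B) cellular_law \<Phi>\<^sub>f"
    and p\<^sub>f: "p\<^sub>f = measure M\<^sub>f {\<omega> \<in> space M\<^sub>f. channel_free \<gamma> \<alpha> (\<Phi>\<^sub>f \<omega>)}"
    \<comment> \<open>probability that enough power is harvested\<close>
    and "prob_space M\<^sub>s"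
    and "prob_space.marked_PPP M\<^sub>s (q\<^sub>c\<^sub>D * lam\<^sub>B) (\<Pi>\<^sub>M c\<in>C\<^sub>D. fading_law) \<Phi>\<^sub>B"
    and "prob_space.marked_PPP M\<^sub>s (q\<^sub>c\<^sub>U * real (card C\<^sub>U) * lam\<^sub>B) user_law \<Phi>\<^sub>U"
    and "prob_space.indep_rv M\<^sub>s (config_space (\<Pi>\<^sub>M c\<in>C\<^sub>D. fading_law)) \<Phi>\<^sub>B
           (config_space user_law) \<Phi>\<^sub>U"
    and p\<^sub>s: "p\<^sub>s = measure M\<^sub>s
           {\<omega> \<in> space M\<^sub>s. harvested_power a P\<^sub>B \<alpha> C\<^sub>D (\<Phi>\<^sub>B \<omega>) (\<Phi>\<^sub>U \<omega>) > ennreal P\<^sub>D}"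
    \<comment> \<open>typical D2D receiver\<close>
    and "prob_space M"
    and "distributed M lborel h\<^sub>o (\<lambda>x. ennreal (exponential_density 1 x))"
    and "prob_space.marked_PPP M (q\<^sub>d * lam\<^sub>B) cellular_law \<Psi>\<^sub>B"
    and "prob_space.marked_PPP M (p\<^sub>s * p\<^sub>f * lam\<^sub>D) fading_law \<Psi>\<^sub>D"
    and I\<^sub>B: "I\<^sub>B = (\<lambda>\<omega>. cellular_interference \<gamma> \<alpha> (\<Psi>\<^sub>B \<omega>))"
    and I\<^sub>D: "I\<^sub>D = (\<lambda>\<omega>. D2D_interference P\<^sub>D \<beta> (\<Psi>\<^sub>D \<omega>))"
    and "prob_space.indep_vars M (\<lambda>_. borel) (\<lambda>i. [\<lambda>\<omega>. ennreal (h\<^sub>o \<omega>), I\<^sub>B, I\<^sub>D] ! i) {..<3}"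
    \<comment> \<open>the constants of the formula\<close>
    and Pbar: "Pbar = (if c\<^sub>d \<in> C\<^sub>D then P\<^sub>B else \<rho>\<^sub>b / (pi * lam\<^sub>B) powr (\<alpha> / 2))"
    and K\<^sub>1: "K\<^sub>1 = \<tau> * noise / \<rho>\<^sub>d
           + 2 * pi\<^sup>2 * d\<^sub>o\<^sup>2 * p\<^sub>s * p\<^sub>f * lam\<^sub>D / (\<beta> * sin (2 * pi / \<beta>)) * \<tau> powr (2 / \<beta>)
           + 2 * pi * q\<^sub>d * lam\<^sub>B / (\<alpha> - 2)
             * G_fun ((\<rho>\<^sub>d / (\<gamma> * \<tau>)) powr (1 / \<alpha>) * Gamma ((\<alpha> + 1) / \<alpha>)) \<alpha>
             * (Pbar / \<rho>\<^sub>d * \<tau>) powr (2 / \<alpha>)"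
  shows "measure M {\<omega> \<in> space M. SINR \<rho>\<^sub>d noise (h\<^sub>o \<omega>) (I\<^sub>B \<omega>) (I\<^sub>D \<omega>) \<le> ennreal \<tau>} = 1 - exp (- K\<^sub>1)"
proof -
  interpret prob_space M by fact
  define s where "s = \<tau> / \<rho>\<^sub>d"
  have s: "0 < s" using pos by (simp add: s_def)
  define L where "L = cellular_power_law (c\<^sub>d \<in> C\<^sub>D) P\<^sub>B lam\<^sub>B \<rho>\<^sub>b \<alpha>"
  have L: "prob_space L" "sets L = sets borel" "AE P in L. 0 < P"
    and L_moment: "(\<integral>\<^sup>+P. ennreal (P powr (2 / \<alpha>)) \<partial>L) = ennreal (Pbar powr (2 / \<alpha>))"
    using cellular_power_law[OF pos(4,1,5), of \<alpha> "c\<^sub>d \<in> C\<^sub>D"] pos(10)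
    unfolding L_def Pbar by simp_all
  have PPP_B: "marked_PPP (q\<^sub>d * lam\<^sub>B) (L \<Otimes>\<^sub>M fading_law) \<Psi>\<^sub>B"
    using \<open>marked_PPP (q\<^sub>d * lam\<^sub>B) cellular_law \<Psi>\<^sub>B\<close> by (simp add: cellular_law L_def)
  have PPP_D: "marked_PPP (p\<^sub>s * p\<^sub>f * lam\<^sub>D) fading_law \<Psi>\<^sub>D" by fact
  have \<mu>B: "0 \<le> q\<^sub>d * lam\<^sub>B" and \<mu>D: "0 \<le> p\<^sub>s * p\<^sub>f * lam\<^sub>D"
    using PPP_B PPP_D poisson_points_intensity_nonneg unfolding marked_PPP_def by blast+

  define K\<^sub>D where "K\<^sub>D = 2 * pi\<^sup>2 * d\<^sub>o\<^sup>2 * p\<^sub>s * p\<^sub>f * lam\<^sub>D / (\<beta> * sin (2 * pi / \<beta>)) * \<tau> powr (2 / \<beta>)"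
  define K\<^sub>B where "K\<^sub>B = 2 * pi * q\<^sub>d * lam\<^sub>B / (\<alpha> - 2)
             * G_fun ((\<rho>\<^sub>d / (\<gamma> * \<tau>)) powr (1 / \<alpha>) * Gamma ((\<alpha> + 1) / \<alpha>)) \<alpha>
             * (Pbar / \<rho>\<^sub>d * \<tau>) powr (2 / \<alpha>)"
  have sin: "0 < sin (2 * pi / \<beta>)"
    using pos by (intro sin_gt_zero) (auto simp: field_simps)
  have K_eq: "K\<^sub>1 = s * noise + K\<^sub>D + K\<^sub>B" by (simp add: K\<^sub>1 K\<^sub>D_def K\<^sub>B_def s_def)

  have lap_D: "(\<integral>\<^sup>+\<omega>. nexp (ennreal s * I\<^sub>D \<omega>) \<partial>M) = ennreal (exp (- K\<^sub>D))" and K\<^sub>D: "0 \<le> K\<^sub>D"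
  proof -
    \<comment> \<open>The receiver sensitivity cancels:
      \<open>s * P\<^sub>D = \<tau> * d\<^sub>o powr \<beta>\<close>. Hence the factor
      \<open>d\<^sub>o\<^sup>2\<close>.\<close>
    have "(s * P\<^sub>D) powr (2 / \<beta>) = d\<^sub>o\<^sup>2 * \<tau> powr (2 / \<beta>)"
      using pos by (simp add: s_def P\<^sub>D powr_mult powr_powr)
    hence "K\<^sub>D = (p\<^sub>s * p\<^sub>f * lam\<^sub>D) * (2 * pi\<^sup>2 / (\<beta> * sin (2 * pi / \<beta>)) * (s * P\<^sub>D) powr (2 / \<beta>))"
      by (simp add: K\<^sub>D_def)
    moreover have "0 \<le> 2 * pi\<^sup>2 / (\<beta> * sin (2 * pi / \<beta>)) * (s * P\<^sub>D) powr (2 / \<beta>)"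
      using pos sin by simp
    ultimately have "0 \<le> K\<^sub>D" and
      "ennreal K\<^sub>D = ennreal (p\<^sub>s * p\<^sub>f * lam\<^sub>D) * ennreal (2 * pi\<^sup>2 / (\<beta> * sin (2 * pi / \<beta>)) * (s * P\<^sub>D) powr (2 / \<beta>))"
      using \<mu>D by (simp_all only: mult_nonneg_nonneg ennreal_mult)
    moreover have "0 \<le> P\<^sub>D" using pos by (simp add: P\<^sub>D)
    ultimately show "(\<integral>\<^sup>+\<omega>. nexp (ennreal s * I\<^sub>D \<omega>) \<partial>M) = ennreal (exp (- K\<^sub>D))" "0 \<le> K\<^sub>D"
      using laplace_D2D_interference[OF PPP_D _ _ less_imp_le[OF s], of \<beta> P\<^sub>D] pos
      by (simp_all add: I\<^sub>D flip: nexp_ennreal)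
  qed

  have lap_B: "(\<integral>\<^sup>+\<omega>. nexp (ennreal s * I\<^sub>B \<omega>) \<partial>M) = ennreal (exp (- K\<^sub>B))" and K\<^sub>B: "0 \<le> K\<^sub>B"
  proof -
    let ?G = "G_fun ((1 / (\<gamma> * s)) powr (1 / \<alpha>) * Gamma (1 + 1 / \<alpha>)) \<alpha>"
    have Pbar_pos: "0 < Pbar" using pos by (simp add: Pbar)
    have y: "1 / (\<gamma> * s) = \<rho>\<^sub>d / (\<gamma> * \<tau>)" "1 + 1 / \<alpha> = (\<alpha> + 1) / \<alpha>"
      using pos by (auto simp: s_def field_simps)
    have "Pbar / \<rho>\<^sub>d * \<tau> = s * Pbar" by (simp add: s_def)
    hence "(Pbar / \<rho>\<^sub>d * \<tau>) powr (2 / \<alpha>) = s powr (2 / \<alpha>) * Pbar powr (2 / \<alpha>)"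
      using Pbar_pos s by (simp add: powr_mult)
    hence K: "K\<^sub>B = (q\<^sub>d * lam\<^sub>B) * ((2 * pi / (\<alpha> - 2) * ?G * s powr (2 / \<alpha>)) * Pbar powr (2 / \<alpha>))"
      unfolding y K\<^sub>B_def by simp
    have nn: "0 \<le> 2 * pi / (\<alpha> - 2) * ?G * s powr (2 / \<alpha>)"
      using pos G_fun_nonneg by simp
    show "0 \<le> K\<^sub>B" unfolding K by (rule mult_nonneg_nonneg[OF \<mu>B mult_nonneg_nonneg[OF nn powr_ge_zero]])
    have "ennreal K\<^sub>B = ennreal (q\<^sub>d * lam\<^sub>B) * (ennreal (2 * pi / (\<alpha> - 2) * ?G * s powr (2 / \<alpha>)) * ennreal (Pbar powr (2 / \<alpha>)))"
      unfolding K ennreal_mult[OF \<mu>B mult_nonneg_nonneg[OF nn powr_ge_zero]] ennreal_mult[OF nn powr_ge_zero] ..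
    with \<open>0 \<le> K\<^sub>B\<close> show "(\<integral>\<^sup>+\<omega>. nexp (ennreal s * I\<^sub>B \<omega>) \<partial>M) = ennreal (exp (- K\<^sub>B))"
      using laplace_cellular_interference[OF PPP_B _ s _ L, of \<alpha> \<gamma>] pos
      by (simp add: I\<^sub>B L_moment flip: nexp_ennreal)
  qed

  let ?Z = "\<lambda>i. [\<lambda>\<omega>. ennreal (h\<^sub>o \<omega>), I\<^sub>B, I\<^sub>D] ! i"
  \<comment> \<open>Index \<open>0\<close> is the gain, which enters unscaled; the interferences
    carry the Laplace argument \<open>s\<close>.\<close>
  define c where "c i = (if i = 0 then 1 else ennreal s)" for i :: nat
  have indep: "indep_vars (\<lambda>_. borel) ?Z {..<3}" by fact
  have three: "{..<3} = insert 0 {1, 2 :: nat}" by auto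
  \<comment> \<open>\<open>Y\<close> is uniform on the unit interval, and \<open>W\<close> is the
    conditional probability of success given the interferences; success is the event
    \<open>Y \<omega> < W \<omega>\<close>.\<close>
  define Y where "Y \<omega> = enn2real (nexp (ennreal (h\<^sub>o \<omega>)))" for \<omega>
  define W where "W \<omega> = exp (- (s * noise)) * (enn2real (nexp (ennreal s * I\<^sub>B \<omega>)) * enn2real (nexp (ennreal s * I\<^sub>D \<omega>)))" for \<omega>
  have "indep_vars (\<lambda>_. borel) (\<lambda>i \<omega>. enn2real (nexp (c i * ?Z i \<omega>))) (insert 0 {1, 2})"
    using indep unfolding three by (rule indep_vars_compose2) measurable
  \<comment> \<open>Grouping the indices as \<open>{0}\<close> and \<open>{1, 2}\<close> makes the
    gain independent of the product of the two interference factors; the constant noise factor is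
    attached afterwards.\<close>
  hence "indep_var borel (\<lambda>\<omega>. enn2real (nexp (c 0 * ?Z 0 \<omega>)))
      borel (\<lambda>\<omega>. \<Prod>i\<in>{1, 2}. enn2real (nexp (c i * ?Z i \<omega>)))"
    by (rule indep_vars_prod[rotated 2]) auto
  hence "indep_var borel (id \<circ> (\<lambda>\<omega>. enn2real (nexp (c 0 * ?Z 0 \<omega>))))
      borel ((\<lambda>x. exp (- (s * noise)) * x) \<circ> (\<lambda>\<omega>. \<Prod>i\<in>{1, 2}. enn2real (nexp (c i * ?Z i \<omega>))))"
    by (rule indep_var_compose) auto
  hence YW: "indep_var borel Y borel W"
    by (simp add: c_def o_def Y_def[abs_def] W_def[abs_def] numeral_2_eq_2)
  have [measurable]: "Y \<in> borel_measurable M" "W \<in> borel_measurable M"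
    using YW unfolding indep_var_distribution_eq by auto

  have ennreal_nexp: "ennreal (enn2real (nexp x)) = nexp x" for x
    by (simp add: nexp_less_top)
  have W_eq: "ennreal (W \<omega>) = nexp (ennreal s * (I\<^sub>B \<omega> + I\<^sub>D \<omega> + ennreal noise))" for \<omega>
  proof -
    have "ennreal (W \<omega>) = ennreal (exp (- (s * noise))) * (nexp (ennreal s * I\<^sub>B \<omega>) * nexp (ennreal s * I\<^sub>D \<omega>))"
      by (simp add: W_def ennreal_mult ennreal_nexp)
    also have "ennreal (exp (- (s * noise))) = nexp (ennreal (s * noise))"
      using s pos by (intro nexp_ennreal[symmetric]) auto
    also have "ennreal (s * noise) = ennreal s * ennreal noise"
      using s pos by (intro ennreal_mult) auto
    finally show ?thesis by (simp add: distrib_left nexp_add mult_ac)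
  qed
  have W01: "0 \<le> W \<omega>" "W \<omega> \<le> 1" for \<omega>
  proof -
    show "0 \<le> W \<omega>" by (simp add: W_def)
    have "ennreal (W \<omega>) \<le> ennreal 1" unfolding W_eq by (simp add: nexp_le_1)
    thus "W \<omega> \<le> 1" by (subst (asm) ennreal_le_iff) auto
  qed

  have "indep_vars (\<lambda>_. borel) ?Z {1, 2}"
    using indep by (rule indep_vars_subset) auto
  hence "indep_vars (\<lambda>_. borel) (\<lambda>i \<omega>. nexp (ennreal s * ?Z i \<omega>)) {1, 2}"
    by (rule indep_vars_compose2) measurable
  from indep_vars_nn_integral[OF _ this]
  have prod: "(\<integral>\<^sup>+\<omega>. nexp (ennreal s * I\<^sub>B \<omega>) * nexp (ennreal s * I\<^sub>D \<omega>) \<partial>M) = ennreal (exp (- K\<^sub>B)) * ennreal (exp (- K\<^sub>D))"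
    by (simp add: numeral_2_eq_2 lap_B lap_D)
  have "random_variable borel (?Z i)" if "i < 3" for i
    using indep that by (simp add: indep_vars_def)
  from this[of 1] this[of 2]
  have [measurable]: "I\<^sub>B \<in> borel_measurable M" "I\<^sub>D \<in> borel_measurable M"
    by (simp_all add: numeral_2_eq_2)
  have "emeasure M {\<omega> \<in> space M. Y \<omega> < W \<omega>} = (\<integral>\<^sup>+\<omega>. ennreal (W \<omega>) \<partial>M)"
    unfolding Y_def by (rule emeasure_exponential_less_indep) (use YW W01 in \<open>simp_all add: Y_def[abs_def] assms\<close>)
  also have "\<dots> = (\<integral>\<^sup>+\<omega>. ennreal (exp (- (s * noise))) * (nexp (ennreal s * I\<^sub>B \<omega>) * nexp (ennreal s * I\<^sub>D \<omega>)) \<partial>M)"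
    by (simp add: W_def ennreal_mult ennreal_nexp)
  also have "\<dots> = ennreal (exp (- (s * noise))) * (ennreal (exp (- K\<^sub>B)) * ennreal (exp (- K\<^sub>D)))"
    by (subst nn_integral_cmult) (auto simp: prod)
  also have "\<dots> = ennreal (exp (- K\<^sub>1))"
    by (simp add: K_eq mult_exp_exp algebra_simps flip: ennreal_mult)
  finally have prob_less: "prob {\<omega> \<in> space M. Y \<omega> < W \<omega>} = exp (- K\<^sub>1)"
    by (simp add: emeasure_eq_measure)

  have "SINR \<rho>\<^sub>d noise (h\<^sub>o \<omega>) (I\<^sub>B \<omega>) (I\<^sub>D \<omega>) \<le> ennreal \<tau> \<longleftrightarrow> \<not> Y \<omega> < W \<omega>" for \<omega>
  proof -
    have "SINR \<rho>\<^sub>d noise (h\<^sub>o \<omega>) (I\<^sub>B \<omega>) (I\<^sub>D \<omega>) \<le> ennreal \<tau> \<longleftrightarrow>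
        ennreal (h\<^sub>o \<omega>) \<le> ennreal s * (I\<^sub>B \<omega> + I\<^sub>D \<omega> + ennreal noise)"
      unfolding s_def using pos by (intro SINR_le_iff) auto
    also have "\<dots> \<longleftrightarrow> ennreal (W \<omega>) \<le> ennreal (Y \<omega>)"
      unfolding W_eq Y_def ennreal_nexp by (simp only: nexp_le_iff)
    also have "\<dots> \<longleftrightarrow> W \<omega> \<le> Y \<omega>"
      by (intro ennreal_le_iff) (simp add: Y_def)
    finally show ?thesis by auto
  qed
  hence "{\<omega> \<in> space M. SINR \<rho>\<^sub>d noise (h\<^sub>o \<omega>) (I\<^sub>B \<omega>) (I\<^sub>D \<omega>) \<le> ennreal \<tau>} = space M - {\<omega> \<in> space M. Y \<omega> < W \<omega>}"
    by auto
  thus ?thesis by (simp add: prob_compl prob_less)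
qed

end
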